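(* Let $T_{\min}>0$ and let the growth condition (defined in the context) hold for the family $\mathcal S_{\min}(T_{\min})$. The following are equivalent: (i) the impulsive system is strongly UGES over $\mathcal S_{\min}(T_{\min})$; (ii) there exist $p\ge1$ and $b>0$ such that for all $\sigma\in\mathcal S_{\min}(T_{\min})$, all $s\ge0$ and all $x\in X$ $$\int_s^\infty\|U_\sigma(t,s)x\|^p\,dt+\sum_{k:\ t_k>s}\|U_\sigma(t_k^-,s)x\|^p\le b^p\|x\|^p;$$ (iii) there exist $p\ge1$, $c>0$ and a functional $\bar V:[0,T_{\min}]\times X\to\mathbb R_{\ge0}$, Lipschitz on bounded subsets of $X$ uniformly in $\tau$ and continuous in $\tau$, extended by $\bar V(\tau,\cdot):=\bar V(T_{\min},\cdot)$ for $\tau\ge T_{\min}$, such that for all $x\in X$ $$\bar V(\tau,x)\le c\|x\|^p\ \ \forall\tau\in[0,T_{\min}],\qquad \underline D^+\bar V(\tau,x)\le-\|x\|^p\ \ \forall\tau\in[0,T_{\min}],$$ $$\underline D^+\bar V(T_{\min},x)\le-\|x\|^p,\qquad \bar V(0,Jx)-\bar V(T_{\min},x)\le-\|x\|^p$$ (these conditions imply, in particular, that the $C_0$-semigroup $S(t)$ is exponentially stable); (iv) the $C_0$-semigroup $S(t)$ is exponentially stable and there exist $p\ge1$, $\hat c>0$ and a functional $V_d:X\to\mathbb R_{\ge0}$, Lipschitz on bounded subsets of $X$, such that $$V_d(x)\le\hat c\|x\|^p,\qquad V_d(S(\theta)Jx)-V_d(x)\le-\|x\|^p,\qquad\forall x\in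 X,\ \theta\ge T_{\min}.$$ Moreover, when (i) holds, an explicit functional witnessing (iii) is $$\bar V(\tau,x):=\sup_{\sigma\in\mathcal S^{(\tau)}}\left[\int_0^\infty\|U_\sigma(s,0)x\|^p\,ds+\sum_{k\ge1}\|U_\sigma(t_k^-,0)x\|^p\right],$$ where, for $\tau\in[0,T_{\min}]$, $$\mathcal S^{(\tau)}:=\{\sigma\in\mathcal S_{0,\infty}:\ t_1^\sigma\ge\max(T_{\min}-\tau,0)\text{ and }t_{k+1}^\sigma-t_k^\sigma\ge T_{\min}\text{ for all }k\ge1\},$$ and $\mathcal S^{(\tau)}:=\mathcal S^{(T_{\min})}$ for $\tau\ge T_{\min}$.
   Context: Setting. $X$ is a Banach space with norm $\|\cdot\|$; $A:D(A)\subset X\to X$ generates a strongly continuous ($C_0$) semigroup $(S(t))_{t\ge0}$ on $X$; $J\in L(X)$ is bounded, $J\neq0$, $JD(A)\subset D(A)$. $\mathcal S_{0,\infty}$ is the set of sequences $\sigma=\{t_k\}_{k\ge1}$ (also written $t_k^\sigma$) with, setting $t_0:=0$, $t_{k+1}>t_k$ for all $k\ge0$ and $t_k\to\infty$; $\mathbb T_\sigma:=\{t_k:k\ge1\}$. $\mathcal S_{\min}(T_{\min}):=\{\sigma\in\mathcal S_{0,\infty}:t_{k+1}-t_k\ge T_{\min}\ \forall k\ge0\}$. The impulsive system is $\dot x(t)=Ax(t)$ for $t\notin\mathbb T_\sigma$, $x(t)=Jx(t^-)$ for $t\in\mathbb T_\sigma$. Its propagator $U_\sigma(t,s)$, $t\ge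 s\ge0$, is: $U_\sigma(t,s)=S(t-s)$ if $(s,t]\cap\mathbb T_\sigma=\varnothing$; otherwise, if $t_l<\dots<t_m$ are the impulse times in $(s,t]$, $U_\sigma(t,s)=S(t-t_m)JS(t_m-t_{m-1})J\cdots JS(t_l-s)$. For $s<t_k$, $U_\sigma(t_k^-,s)x:=\lim_{t\uparrow t_k}U_\sigma(t,s)x$. $\kappa_\sigma(t,s):=\#(\mathbb T_\sigma\cap(s,t])$. Strong UGES over a family $\mathcal S$: there exist $M\ge1$, $\alpha>0$, $\rho\in(0,1)$ such that $\|U_\sigma(t,s)\|\le M\rho^{\kappa_\sigma(t,s)}e^{-\alpha(t-s)}$ for all $t\ge s\ge0$ and all $\sigma\in\mathcal S$. Growth condition for $\mathcal S_{\min}(T_{\min})$: there exist a piecewise continuous $g:\mathbb R_{\ge0}\to\mathbb R_{>0}$ bounded below by some $c_0>0$, and $\mu>1$, such that $\|U_\sigma(t,s)x\|\le g(t-s)\mu^{\kappa_\sigma(t,s)}\|x\|$ for all $t\ge s\ge0$, $x\in X$, $\sigma\in\mathcal S_{\min}(T_{\min})$, and $\sup_{\tau\ge0}g(\tau)<\infty$. Functionals. $\bar V$ is Lipschitz on bounded subsets of $X$ uniformly in $\tau$ if for every $r>0$ there is $L_r>0$ with $|\bar V(\tau,x)-\bar V(\tau,y)|\le L_r\|x-y\|$ for all $\|x\|,\|y\|<r$ and all $\tau$ (similarly for $V_d$, without $\tau$). $\underline D^+\bar V(\tau,x):=\liminf_{h\downarrow0}h^{-1}\big(\bar V(\tau+h,S(h)x)-\bar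 V(\tau,x)\big)$. *)

theory Defs
  imports "HOL-Analysis.Analysis"
begin

definition C0_semigroup :: "(real \<Rightarrow> ('a::banach \<Rightarrow>\<^sub>L 'a)) \<Rightarrow> bool" where
  "C0_semigroup S \<longleftrightarrow>
     S 0 = id_blinfun \<and>
     (\<forall>s\<ge>0. \<forall>t\<ge>0. S (s + t) = S s o\<^sub>L S t) \<and>
     (\<forall>x. ((\<lambda>t. blinfun_apply (S t) x) \<longlongrightarrow> x) (at_right 0))"

text \<open>
  An unbounded operator is given by its domain \<open>D\<close> and a map \<open>A\<close> whose values outside \<open>D\<close> are
  irrelevant. The values of \<open>S\<close> at negative times are irrelevant as well.
\<close>

definition generates_C0_semigroup ::
    "'a::banach set \<Rightarrow> ('a \<Rightarrow> 'a) \<Rightarrow> (real \<Rightarrow> ('a \<Rightarrow>\<^sub>L 'a)) \<Rightarrow> bool" where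
  "generates_C0_semigroup D A S \<longleftrightarrow>
     C0_semigroup S \<and>
     D = {x. \<exists>y. ((\<lambda>h. (1 / h) *\<^sub>R (blinfun_apply (S h) x - x)) \<longlongrightarrow> y) (at_right 0)} \<and>
     (\<forall>x\<in>D. ((\<lambda>h. (1 / h) *\<^sub>R (blinfun_apply (S h) x - x)) \<longlongrightarrow> A x) (at_right 0))"

definition exponentially_stable :: "(real \<Rightarrow> ('a::banach \<Rightarrow>\<^sub>L 'a)) \<Rightarrow> bool" where
  "exponentially_stable S \<longleftrightarrow>
     (\<exists>M\<ge>1. \<exists>\<omega>>0. \<forall>t\<ge>0. norm (S t) \<le> M * exp (- \<omega> * t))"

text \<open>
  A sequence \<open>{t\<^sub>k}\<close>, \<open>k \<ge> 1\<close>, of impulse times is a function on all of \<open>nat\<close> whose value at \<open>0\<close> is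
  the convention \<open>t\<^sub>0 = 0\<close>; the time \<open>t\<^sub>0\<close> itself is not an impulse time.
\<close>

definition impulse_seqs :: "(nat \<Rightarrow> real) set" where
  "impulse_seqs = {\<sigma>. \<sigma> 0 = 0 \<and> (\<forall>k. \<sigma> k < \<sigma> (k + 1)) \<and> filterlim \<sigma> at_top sequentially}"

definition impulse_times :: "(nat \<Rightarrow> real) \<Rightarrow> real set" where
  "impulse_times \<sigma> = \<sigma> ` {1..}"

definition S_min :: "real \<Rightarrow> (nat \<Rightarrow> real) set" where
  "S_min T = {\<sigma> \<in> impulse_seqs. \<forall>k. \<sigma> (k + 1) - \<sigma> k \<ge> T}"

text \<open>The inner minimum encodes that the class for \<open>\<tau> \<ge> T\<close> is the one for \<open>\<tau> = T\<close>.\<close>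

definition S_clock :: "real \<Rightarrow> real \<Rightarrow> (nat \<Rightarrow> real) set" where
  "S_clock T \<tau> = {\<sigma> \<in> impulse_seqs.
     \<sigma> 1 \<ge> max (T - min \<tau> T) 0 \<and> (\<forall>k\<ge>1. \<sigma> (k + 1) - \<sigma> k \<ge> T)}"

text \<open>
  \<open>propagate S J t s [t\<^sub>l, \<dots>, t\<^sub>m]\<close> is the composition
  \<open>S(t - t\<^sub>m) J S(t\<^sub>m - t\<^sub>m\<^sub>-\<^sub>1) J \<dots> J S(t\<^sub>l - s)\<close>.
\<close>

fun propagate :: "(real \<Rightarrow> ('a::banach \<Rightarrow>\<^sub>L 'a)) \<Rightarrow> ('a \<Rightarrow>\<^sub>L 'a) \<Rightarrow> real \<Rightarrow> real \<Rightarrow> real list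
    \<Rightarrow> ('a \<Rightarrow>\<^sub>L 'a)" where
  "propagate S J t s [] = S (t - s)"
| "propagate S J t s (r # rs) = propagate S J t r rs o\<^sub>L J o\<^sub>L S (r - s)"

definition U :: "(real \<Rightarrow> ('a::banach \<Rightarrow>\<^sub>L 'a)) \<Rightarrow> ('a \<Rightarrow>\<^sub>L 'a) \<Rightarrow> (nat \<Rightarrow> real) \<Rightarrow> real \<Rightarrow> real
    \<Rightarrow> ('a \<Rightarrow>\<^sub>L 'a)" where
  "U S J \<sigma> t s = propagate S J t s (sorted_list_of_set (impulse_times \<sigma> \<inter> {s<..t}))"

definition U_left :: "(real \<Rightarrow> ('a::banach \<Rightarrow>\<^sub>L 'a)) \<Rightarrow> ('a \<Rightarrow>\<^sub>L 'a) \<Rightarrow> (nat \<Rightarrow> real) \<Rightarrow> nat \<Rightarrow> real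
    \<Rightarrow> 'a \<Rightarrow> 'a" where
  "U_left S J \<sigma> k s x = Lim (at_left (\<sigma> k)) (\<lambda>t. blinfun_apply (U S J \<sigma> t s) x)"

definition \<kappa> :: "(nat \<Rightarrow> real) \<Rightarrow> real \<Rightarrow> real \<Rightarrow> nat" where
  "\<kappa> \<sigma> t s = card (impulse_times \<sigma> \<inter> {s<..t})"

definition strongly_UGES ::
    "(real \<Rightarrow> ('a::banach \<Rightarrow>\<^sub>L 'a)) \<Rightarrow> ('a \<Rightarrow>\<^sub>L 'a) \<Rightarrow> (nat \<Rightarrow> real) set \<Rightarrow> bool" where
  "strongly_UGES S J \<S> \<longleftrightarrow>
     (\<exists>M\<ge>1. \<exists>\<alpha>>0. \<exists>\<rho>. 0 < \<rho> \<and> \<rho> < 1 \<and>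
        (\<forall>\<sigma>\<in>\<S>. \<forall>s\<ge>0. \<forall>t\<ge>s.
           norm (U S J \<sigma> t s) \<le> M * \<rho> ^ \<kappa> \<sigma> t s * exp (- \<alpha> * (t - s))))"

text \<open>Finitely many discontinuities in every bounded interval, all with finite one-sided limits.\<close>

definition piecewise_continuous :: "(real \<Rightarrow> real) \<Rightarrow> bool" where
  "piecewise_continuous g \<longleftrightarrow>
     (\<forall>T\<ge>0. finite {t \<in> {0..T}. \<not> continuous (at t within {0..}) g}) \<and>
     (\<forall>t\<ge>0. \<exists>l. (g \<longlongrightarrow> l) (at_right t)) \<and>
     (\<forall>t>0. \<exists>l. (g \<longlongrightarrow> l) (at_left t))"

definition growth_condition ::
    "(real \<Rightarrow> ('a::banach \<Rightarrow>\<^sub>L 'a)) \<Rightarrow> ('a \<Rightarrow>\<^sub>L 'a) \<Rightarrow> (nat \<Rightarrow> real) set \<Rightarrow> bool" where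
  "growth_condition S J \<S> \<longleftrightarrow>
     (\<exists>g c\<^sub>0 \<mu>. piecewise_continuous g \<and> 0 < c\<^sub>0 \<and> (\<forall>\<tau>\<ge>0. c\<^sub>0 \<le> g \<tau>) \<and> 1 < \<mu> \<and>
        (\<forall>\<sigma>\<in>\<S>. \<forall>s\<ge>0. \<forall>t\<ge>s. \<forall>x.
           norm (blinfun_apply (U S J \<sigma> t s) x) \<le> g (t - s) * \<mu> ^ \<kappa> \<sigma> t s * norm x) \<and>
        bdd_above (g ` {0..}))"

text \<open>
  The integral and the series have nonnegative terms and are taken in \<open>[0, \<infinity>]\<close>, so that
  divergence is recorded as \<open>\<infinity>\<close> and not as a default value.
\<close>

definition trajectory_cost :: "(real \<Rightarrow> ('a::banach \<Rightarrow>\<^sub>L 'a)) \<Rightarrow> ('a \<Rightarrow>\<^sub>L 'a) \<Rightarrow> real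
    \<Rightarrow> (nat \<Rightarrow> real) \<Rightarrow> real \<Rightarrow> 'a \<Rightarrow> ennreal" where
  "trajectory_cost S J p \<sigma> s x =
     (\<integral>\<^sup>+t\<in>{s..}. ennreal (norm (blinfun_apply (U S J \<sigma> t s) x) powr p) \<partial>lborel) +
     (\<Sum>\<^sub>\<infinity>k\<in>{k. 1 \<le> k \<and> s < \<sigma> k}. ennreal (norm (U_left S J \<sigma> k s x) powr p))"

definition V_sup :: "(real \<Rightarrow> ('a::banach \<Rightarrow>\<^sub>L 'a)) \<Rightarrow> ('a \<Rightarrow>\<^sub>L 'a) \<Rightarrow> real \<Rightarrow> real \<Rightarrow> real \<Rightarrow> 'a
    \<Rightarrow> ennreal" where
  "V_sup S J T p \<tau> x = (SUP \<sigma>\<in>S_clock T \<tau>. trajectory_cost S J p \<sigma> 0 x)"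

definition lower_Dini :: "(real \<Rightarrow> ('a::banach \<Rightarrow>\<^sub>L 'a)) \<Rightarrow> (real \<Rightarrow> 'a \<Rightarrow> real) \<Rightarrow> real \<Rightarrow> 'a
    \<Rightarrow> ereal" where
  "lower_Dini S V \<tau> x =
     Liminf (at_right 0) (\<lambda>h. ereal ((V (\<tau> + h) (blinfun_apply (S h) x) - V \<tau> x) / h))"

text \<open>
  The functional \<open>V\<close> is given together with its constant extension beyond \<open>T\<close>.
\<close>

definition clock_Lyapunov :: "(real \<Rightarrow> ('a::banach \<Rightarrow>\<^sub>L 'a)) \<Rightarrow> ('a \<Rightarrow>\<^sub>L 'a) \<Rightarrow> real \<Rightarrow> real \<Rightarrow> real
    \<Rightarrow> (real \<Rightarrow> 'a \<Rightarrow> real) \<Rightarrow> bool" where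
  "clock_Lyapunov S J T p c V \<longleftrightarrow>
     (\<forall>\<tau>\<in>{0..T}. \<forall>x. 0 \<le> V \<tau> x) \<and>
     (\<forall>r>0. \<exists>L>0. \<forall>\<tau>\<in>{0..T}. L-lipschitz_on (ball 0 r) (V \<tau>)) \<and>
     (\<forall>x. continuous_on {0..T} (\<lambda>\<tau>. V \<tau> x)) \<and>
     (\<forall>\<tau>\<ge>T. V \<tau> = V T) \<and>
     (\<forall>x. (\<forall>\<tau>\<in>{0..T}. V \<tau> x \<le> c * norm x powr p) \<and>
          (\<forall>\<tau>\<in>{0..T}. lower_Dini S V \<tau> x \<le> ereal (- (norm x powr p))) \<and>
          lower_Dini S V T x \<le> ereal (- (norm x powr p)) \<and>
          V 0 (blinfun_apply J x) - V T x \<le> - (norm x powr p))"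

end

theory Submission
  imports Defs
begin

text \<open>
  Condition (i) implies (ii) and, through the functional \<open>V_sup\<close>, condition (iii); evaluating a clock
  functional at the clock value \<open>T\<close> turns (iii) into (iv); and both (iv) and (ii) lead back to (i).
  The growth condition enters as a uniform bound on the semigroup, read off from an impulse
  sequence whose first impulse comes late.

  The supremum \<open>V_sup\<close> is a value function, and two ways of building a longer impulse sequence
  out of a given one \<open>\<sigma>\<close> yield its two dissipation inequalities. Moving all of \<open>\<sigma>\<close> to the right by
  \<open>h\<close> puts a piece of free flow of length \<open>h\<close> in front (\<open>trajectory_cost_delay\<close>). Since this lowers
  the required clock value by \<open>h\<close>, it gives \<open>V (\<tau> + h) (S h x) + \<integral>\<^sub>0\<^sup>h \<parallel>S t x\<parallel>\<^sup>p dt \<le> V \<tau> x\<close>, hence the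
  Dini inequality. Putting one further impulse at a time \<open>\<theta>\<close> in front (\<open>trajectory_cost_prepend\<close>)
  gives \<open>\<parallel>S \<theta> x\<parallel>\<^sup>p + V 0 (J (S \<theta> x)) \<le> V T x\<close>; an impulse exactly at time \<open>0\<close> is not admitted, so the
  jump inequality is the limit \<open>\<theta> \<rightarrow> 0\<close>. The decay in (i) makes the costs finite and Lipschitz on
  bounded sets, with constants common to all sequences, so both properties pass to the supremum.
  Continuity in the clock follows from the first inequality and the Lipschitz bound, because they
  place \<open>V (\<tau> + h) x - V \<tau> x\<close> between \<open>0\<close> and a multiple of \<open>\<parallel>S h x - x\<parallel>\<close>.

  A clock functional decreases along the semigroup at rate \<open>\<parallel>\<cdot>\<parallel>\<^sup>p\<close>
  (\<open>clock_Lyapunov_flow\<close>). For the clock value \<open>T\<close> this bounds the time that an orbit of \<open>S\<close> can spend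
  away from \<open>0\<close>, and for a bounded semigroup this forces exponential stability
  (\<open>exponentially_stable_if_orbit_bound\<close>, a simple case of Datko's theorem). Started at the clock
  value \<open>0\<close>, it gives the decrease from one impulse to the next that (iv) asks for.

  For the way back to (i), let \<open>W\<close> satisfy
  \<open>\<parallel>x\<parallel>\<^sup>p + W (S \<theta> (J x)) \<le> W x \<le> c \<parallel>x\<parallel>\<^sup>p\<close> for all \<open>\<theta> \<ge> T\<close>. Then \<open>W\<close> is comparable to \<open>\<parallel>\<cdot>\<parallel>\<^sup>p\<close>, and one step
  \<open>x \<mapsto> S \<theta> (J x)\<close> contracts \<open>W\<close> by a fixed factor less than \<open>1\<close>, and also by \<open>K exp (- \<gamma> \<theta>)\<close> because
  \<open>S\<close> is exponentially stable. Interpolating the two bounds gives a factor \<open>q exp (- \<beta> \<theta>)\<close> with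
  \<open>q < 1\<close>, and the product of these factors is decay in the number of impulses and in time at
  once (\<open>strongly_UGES_if_impulse_to_impulse_decrease\<close>). In (iv) the functional \<open>W\<close> is given; under
  (ii) take \<open>W x = \<parallel>x\<parallel>\<^sup>p + V 0 (J x)\<close>, for which the inequality is the one obtained by putting an
  impulse in front.
\<close>

section \<open>Propagation past finitely many impulses\<close>

lemma sorted_list_of_set_append:
  fixes A B :: "'b::linorder set"
  assumes "finite A" "finite B" "\<And>a b. a \<in> A \<Longrightarrow> b \<in> B \<Longrightarrow> a < b"
  shows "sorted_list_of_set (A \<union> B) = sorted_list_of_set A @ sorted_list_of_set B"
proof (rule strict_sorted_equal)
  show "sorted_wrt (<) (sorted_list_of_set (A \<union> B))" by simp
  show "sorted_wrt (<) (sorted_list_of_set A @ sorted_list_of_set B)"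
    using assms by (simp add: sorted_wrt_append)
qed (use assms in simp)

lemma sorted_list_of_set_shift:
  fixes A :: "real set"
  assumes "finite A"
  shows "sorted_list_of_set ((\<lambda>a. a + r) ` A) = map (\<lambda>a. a + r) (sorted_list_of_set A)"
proof (rule strict_sorted_equal)
  show "sorted_wrt (<) (sorted_list_of_set ((\<lambda>a. a + r) ` A))" by simp
  show "sorted_wrt (<) (map (\<lambda>a. a + r) (sorted_list_of_set A))"
    by (simp add: sorted_wrt_map)
qed (use assms in simp)

lemma propagate_shift:
  "propagate S J (t + r) (s + r) (map (\<lambda>a. a + r) L) = propagate S J t s L"
  by (induction L arbitrary: s) auto

lemma impulse_seqs_strict_mono: "\<sigma> \<in> impulse_seqs \<Longrightarrow> strict_mono \<sigma>"
  by (auto simp: impulse_seqs_def strict_mono_Suc_iff)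

lemma impulse_seqs_pos: "\<sigma> \<in> impulse_seqs \<Longrightarrow> 1 \<le> k \<Longrightarrow> 0 < \<sigma> k"
  using impulse_seqs_strict_mono[of \<sigma>] strict_monoD[of \<sigma> 0 k] by (auto simp: impulse_seqs_def)

text \<open>
  Impulse times do not accumulate, so only finitely many of them lie below any bound; this is what makes
  the sorted lists in the propagator meaningful.
\<close>
lemma finite_impulse_times_upto:
  assumes "\<sigma> \<in> impulse_seqs" "A \<subseteq> {..b}"
  shows "finite (impulse_times \<sigma> \<inter> A)"
proof -
  have "eventually (\<lambda>k. \<sigma> k > b) sequentially"
    using assms(1) by (auto simp: impulse_seqs_def filterlim_at_top_dense)
  then obtain N where "\<And>k. k \<ge> N \<Longrightarrow> \<sigma> k > b"
    by (auto simp: eventually_sequentially)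
  then have "impulse_times \<sigma> \<inter> A \<subseteq> \<sigma> ` {..<N}"
    using assms(2) by (force simp: impulse_times_def not_le[symmetric])
  then show ?thesis by (rule finite_subset) auto
qed

lemma countable_impulse_times: "countable (impulse_times \<sigma>)"
  by (simp add: impulse_times_def)

lemma no_impulse_before_first:
  assumes "\<sigma> \<in> impulse_seqs" "t < \<sigma> 1"
  shows "impulse_times \<sigma> \<inter> {s<..t} = {}"
proof -
  have "t < \<sigma> k" if "1 \<le> k" for k
    using strict_mono_less_eq[OF impulse_seqs_strict_mono[OF assms(1)], of 1 k] that assms(2) by simp
  then show ?thesis by (force simp: impulse_times_def)
qed

text \<open>
  Bounds \<open>G < 1\<close> can occur on the trivial space alone, where the norm of the identity is \<open>0\<close>; excluding
  them makes division by \<open>G\<close> and \<open>\<parallel>x\<parallel> \<le> G \<parallel>x\<parallel>\<close> available.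
\<close>
locale impulsive_flow =
  fixes S :: "real \<Rightarrow> ('a::banach \<Rightarrow>\<^sub>L 'a)" and J :: "'a \<Rightarrow>\<^sub>L 'a" and G :: real
  assumes C0: "C0_semigroup S"
    and G_ge_1: "1 \<le> G"
    and S_bound: "0 \<le> t \<Longrightarrow> norm (S t) \<le> G"
begin

lemma S_0 [simp]: "S 0 = id_blinfun"
  using C0 by (simp add: C0_semigroup_def)

lemma S_add: "0 \<le> s \<Longrightarrow> 0 \<le> t \<Longrightarrow> S (s + t) = S s o\<^sub>L S t"
  using C0 by (simp add: C0_semigroup_def)

lemma S_le: "0 \<le> t \<Longrightarrow> norm (S t x) \<le> G * norm x"
  by (rule norm_blinfun[THEN order_trans]) (simp add: S_bound mult_right_mono)

lemma S_tendsto_0: "((\<lambda>t. S t x) \<longlongrightarrow> x) (at_right 0)"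
  using C0 by (simp add: C0_semigroup_def)

lemma S_increment_le:
  assumes "0 \<le> s" "0 \<le> t"
  shows "norm (S t x - S s x) \<le> G * norm (S \<bar>t - s\<bar> x - x)"
proof -
  have *: "norm (S b x - S a x) \<le> G * norm (S (b - a) x - x)" if "0 \<le> a" "a \<le> b" for a b
  proof -
    have "S b x - S a x = S a (S (b - a) x - x)"
      using S_add[of a "b - a"] that by (simp add: blinfun.diff_right)
    then show ?thesis using S_le[of a] that by simp
  qed
  show ?thesis
    using *[of s t] *[of t s] assms by (cases "s \<le> t") (auto simp: norm_minus_commute)
qed

lemma S_near_0:
  assumes "0 < e"
  obtains d where "0 < d" "\<And>h. 0 \<le> h \<Longrightarrow> h < d \<Longrightarrow> norm (S h x - x) < e"
proof -
  have "eventually (\<lambda>t. dist (S t x) x < e) (at_right 0)"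
    using S_tendsto_0 assms by (rule tendstoD)
  then obtain d where "0 < d" and d: "\<And>y. 0 < y \<Longrightarrow> y < d \<Longrightarrow> dist (S y x) x < e"
    by (auto simp: eventually_at_right_field)
  have "norm (S h x - x) < e" if "0 \<le> h" "h < d" for h
    using d[of h] that assms by (cases "h = 0") (auto simp: dist_norm)
  then show thesis using that \<open>0 < d\<close> by blast
qed

lemma continuous_on_S: "continuous_on {0..} (\<lambda>t. S t x)"
  unfolding continuous_on_iff
proof (intro ballI allI impI)
  fix t e :: real assume "t \<in> {0..}" "0 < e"
  have "0 < e / G" using \<open>0 < e\<close> G_ge_1 by simp
  then obtain d where "0 < d" and d: "\<And>h. 0 \<le> h \<Longrightarrow> h < d \<Longrightarrow> norm (S h x - x) < e / G"
    using S_near_0 by blast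
  have "dist (S t' x) (S t x) < e" if "t' \<in> {0..}" "dist t' t < d" for t'
  proof -
    have "norm (S t' x - S t x) \<le> G * norm (S \<bar>t' - t\<bar> x - x)"
      using that \<open>t \<in> {0..}\<close> by (intro S_increment_le) auto
    also have "\<dots> < G * (e / G)"
      using d[of "\<bar>t' - t\<bar>"] that G_ge_1 by (intro mult_strict_left_mono) (auto simp: dist_real_def)
    finally show ?thesis using G_ge_1 by (simp add: dist_norm)
  qed
  then show "\<exists>d>0. \<forall>t'\<in>{0..}. dist t' t < d \<longrightarrow> dist (S t' x) (S t x) < e"
    using \<open>0 < d\<close> by blast
qed

lemma continuous_on_propagate:
  assumes "s \<le> a" "\<And>r. r \<in> set L \<Longrightarrow> r \<le> a"
  shows "continuous_on {a..} (\<lambda>t. propagate S J t s L x)"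
  using assms
proof (induction L arbitrary: s x)
  case Nil
  have "continuous_on {a..} (\<lambda>t. S (t - s) x)"
    by (rule continuous_on_compose2[OF continuous_on_S]) (use Nil in \<open>auto intro!: continuous_intros\<close>)
  then show ?case by simp
next
  case (Cons r L)
  then show ?case by simp
qed

lemma propagate_append:
  assumes "s \<le> r" "r \<le> t" "\<And>a. a \<in> set L1 \<Longrightarrow> a \<le> r" "\<And>a. a \<in> set L2 \<Longrightarrow> r \<le> a"
  shows "propagate S J t s (L1 @ L2) = propagate S J t r L2 o\<^sub>L propagate S J r s L1"
  using assms
proof (induction L1 arbitrary: s)
  case Nil
  then show ?case
  proof (cases L2)
    case Nil
    then show ?thesis using S_add[of "t - r" "r - s"] \<open>s \<le> r\<close> \<open>r \<le> t\<close> by simp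
  next
    case (Cons a L)
    then show ?thesis
      using S_add[of "a - r" "r - s"] \<open>s \<le> r\<close> Nil(4)[of a] by (auto intro!: blinfun_eqI)
  qed
next
  case (Cons a L1)
  then show ?case by (auto intro!: blinfun_eqI)
qed

text \<open>
  Both \<open>U\<close> and the left limits \<open>U_left\<close> have this form; they differ only in whether an impulse
  at the final time belongs to the set.
\<close>
abbreviation flow :: "real \<Rightarrow> real \<Rightarrow> real set \<Rightarrow> ('a \<Rightarrow>\<^sub>L 'a)" where
  "flow t s A \<equiv> propagate S J t s (sorted_list_of_set A)"

lemma flow_split:
  assumes "s \<le> r" "r \<le> t" "finite A" "finite B" "A \<subseteq> {..r}" "B \<subseteq> {r<..}"
  shows "flow t s (A \<union> B) = flow t r B o\<^sub>L flow r s A"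
proof -
  have "sorted_list_of_set (A \<union> B) = sorted_list_of_set A @ sorted_list_of_set B"
    using assms by (intro sorted_list_of_set_append) force+
  then show ?thesis
    using assms by (auto intro!: propagate_append)
qed

lemma U_split:
  assumes "\<sigma> \<in> impulse_seqs" "s \<le> r" "r \<le> t"
  shows "U S J \<sigma> t s = U S J \<sigma> t r o\<^sub>L U S J \<sigma> r s"
proof -
  have *: "impulse_times \<sigma> \<inter> {s<..t} = (impulse_times \<sigma> \<inter> {s<..r}) \<union> (impulse_times \<sigma> \<inter> {r<..t})"
    using assms by auto
  show ?thesis
    unfolding U_def * using assms
    by (intro flow_split finite_impulse_times_upto[where b=r] finite_impulse_times_upto[where b=t]) auto
qed

lemma U_no_impulse:
  assumes "impulse_times \<sigma> \<inter> {s<..t} = {}"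
  shows "U S J \<sigma> t s = S (t - s)"
  by (simp add: U_def assms)

text \<open>
  Just to the left of \<open>b\<close> the set of impulses already passed no longer changes, and for a fixed set
  the propagator is strongly continuous in its final time.
\<close>
lemma U_tendsto_left:
  assumes "\<sigma> \<in> impulse_seqs" "s < b"
  shows "((\<lambda>t. U S J \<sigma> t s x) \<longlongrightarrow> flow b s (impulse_times \<sigma> \<inter> {s<..<b}) x) (at_left b)"
proof -
  define A where "A = impulse_times \<sigma> \<inter> {s<..<b}"
  have fin: "finite A"
    unfolding A_def by (rule finite_impulse_times_upto[OF assms(1), of _ b]) auto
  define r where "r = Max (insert s A)"
  have r: "s \<le> r" "\<And>a. a \<in> A \<Longrightarrow> a \<le> r" "r < b"
    using fin assms(2) by (auto simp: r_def A_def)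
  have "((\<lambda>t. flow t s A x) \<longlongrightarrow> flow b s A x) (at b within {r..})"
    using continuous_on_propagate[of s r "sorted_list_of_set A" x] r fin
    by (auto simp: continuous_on_def)
  then have "((\<lambda>t. flow t s A x) \<longlongrightarrow> flow b s A x) (at b within {r..<b})"
    by (rule tendsto_within_subset) auto
  moreover have "at b within {r..<b} = at_left b"
    using r by (intro at_within_nhd[where S = "{r<..}"]) auto
  ultimately have lim: "((\<lambda>t. flow t s A x) \<longlongrightarrow> flow b s A x) (at_left b)" by simp
  have "impulse_times \<sigma> \<inter> {s<..t} = A" if "r < t" "t < b" for t
    using that r by (fastforce simp: A_def)
  then have "eventually (\<lambda>t. flow t s A x = U S J \<sigma> t s x) (at_left b)"
    unfolding eventually_at_left_field U_def using r(3) by (metis (no_types))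
  then show ?thesis
    using lim by (auto simp: A_def[symmetric] elim: Lim_transform_eventually)
qed

lemma U_left_eq:
  assumes "\<sigma> \<in> impulse_seqs" "s < \<sigma> k"
  shows "U_left S J \<sigma> k s x = flow (\<sigma> k) s (impulse_times \<sigma> \<inter> {s<..<\<sigma> k}) x"
  unfolding U_left_def by (rule tendsto_Lim) (use U_tendsto_left[OF assms] in auto)

lemma U_left_split:
  assumes "\<sigma> \<in> impulse_seqs" "s \<le> r" "r < \<sigma> k"
  shows "U_left S J \<sigma> k s x = U_left S J \<sigma> k r (U S J \<sigma> r s x)"
proof -
  have *: "impulse_times \<sigma> \<inter> {s<..<\<sigma> k}
      = (impulse_times \<sigma> \<inter> {s<..r}) \<union> (impulse_times \<sigma> \<inter> {r<..<\<sigma> k})"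
    using assms by auto
  have "flow (\<sigma> k) s (impulse_times \<sigma> \<inter> {s<..<\<sigma> k})
      = flow (\<sigma> k) r (impulse_times \<sigma> \<inter> {r<..<\<sigma> k}) o\<^sub>L U S J \<sigma> r s"
    unfolding * U_def using assms
    by (intro flow_split finite_impulse_times_upto[where b=r] finite_impulse_times_upto[where b="\<sigma> k"]) auto
  then show ?thesis using assms by (simp add: U_left_eq)
qed

text \<open>
  Away from the impulse times the set of impulses passed is locally constant.
\<close>
lemma isCont_U:
  assumes "\<sigma> \<in> impulse_seqs" "s < b" "b \<notin> impulse_times \<sigma>"
  shows "isCont (\<lambda>t. U S J \<sigma> t s x) b"
proof -
  define A where "A = impulse_times \<sigma> \<inter> {s<..b}"
  define B where "B = impulse_times \<sigma> \<inter> {b..b+1}"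
  have fin: "finite A" "finite B"
    unfolding A_def B_def by (rule finite_impulse_times_upto[OF assms(1), of _ "b+1"]; auto)+
  define r where "r = Max (insert s A)"
  define q where "q = Min (insert (b+1) B)"
  have r: "s \<le> r" "\<And>a. a \<in> A \<Longrightarrow> a \<le> r" "r < b"
  proof -
    have "r \<in> insert s A" unfolding r_def by (rule Max_in) (use fin in auto)
    then show "r < b" using assms(2,3) by (auto simp: A_def less_le)
  qed (use fin in \<open>auto simp: r_def\<close>)
  have q: "\<And>a. a \<in> B \<Longrightarrow> q \<le> a" "b < q" "q \<le> b + 1"
  proof -
    have "q \<in> insert (b + 1) B" unfolding q_def by (rule Min_in) (use fin in auto)
    then show "b < q" using assms(3) by (auto simp: B_def less_le)
  qed (use fin in \<open>auto simp: q_def\<close>)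
  have "isCont (\<lambda>t. flow t s A x) b"
    using continuous_on_propagate[of s r "sorted_list_of_set A" x] r fin
    by (intro continuous_on_interior[where S="{r..}"]) auto
  moreover have "impulse_times \<sigma> \<inter> {s<..t} = A" if "t \<in> {r<..<q}" for t
    using that r q assms(3) by (fastforce simp: A_def B_def)
  then have "flow t s A x = U S J \<sigma> t s x" if "t \<in> {r<..<q}" for t
    using that by (simp add: U_def)
  then have "eventually (\<lambda>t. flow t s A x = U S J \<sigma> t s x) (nhds b)"
    using eventually_nhds_in_open[of "{r<..<q}" b] r(3) q(2) by (auto elim!: eventually_mono)
  ultimately show ?thesis
    using isCont_cong[of "\<lambda>t. flow t s A x" "\<lambda>t. U S J \<sigma> t s x" b] by simp
qed

text \<open>
  The integrand of the cost has countably many discontinuities. Measurability is needed because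
  the integral over an interval has to be split and shifted, not only estimated from above.
\<close>
lemma measurable_U:
  assumes "\<sigma> \<in> impulse_seqs" "0 < p"
  shows "(\<lambda>t. ennreal (norm (U S J \<sigma> t s x) powr p) * indicator {s..} t) \<in> borel_measurable borel"
proof -
  let ?f = "\<lambda>t. norm (U S J \<sigma> t s x) powr p * indicator {s..} t"
  have "isCont ?f t" if "t \<noteq> s" "t \<notin> impulse_times \<sigma>" for t
  proof (cases "s < t")
    case True
    have "eventually (\<lambda>u. norm (U S J \<sigma> u s x) powr p = ?f u) (nhds t)"
      using eventually_nhds_in_open[of "{s<..}" t] True by (auto elim!: eventually_mono)
    moreover have "isCont (\<lambda>u. norm (U S J \<sigma> u s x) powr p) t"
      using isCont_U[OF assms(1) True that(2), of x] assms(2)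
      by (auto intro!: tendsto_powr2 tendsto_intros simp: isCont_def)
    ultimately show ?thesis by (subst (asm) isCont_cong) auto
  next
    case False
    then have "eventually (\<lambda>u. 0 = ?f u) (nhds t)"
      using eventually_nhds_in_open[of "{..<s}" t] that by (auto elim!: eventually_mono)
    then show ?thesis using isCont_cong[of "\<lambda>_. 0" ?f t] by auto
  qed
  then have "continuous_on (- (insert s (impulse_times \<sigma>))) ?f"
    by (intro continuous_at_imp_continuous_on) auto
  then have "?f \<in> borel_measurable borel"
    using countable_impulse_times by (intro borel_measurable_continuous_countable_exceptions) auto
  then have "(\<lambda>t. ennreal (?f t)) \<in> borel_measurable borel" by measurable
  also have "(\<lambda>t. ennreal (?f t)) = (\<lambda>t. ennreal (norm (U S J \<sigma> t s x) powr p) * indicator {s..} t)"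
    by (auto simp: indicator_def)
  finally show ?thesis .
qed

end

section \<open>Costs of delayed and extended impulse sequences\<close>

lemma ennreal_summable_on: "(f :: 'b \<Rightarrow> ennreal) summable_on A"
  by (rule nonneg_summable_on_complete) simp

lemma infsum_ennreal_mono:
  fixes f g :: "'b \<Rightarrow> ennreal"
  shows "(\<And>x. x \<in> A \<Longrightarrow> f x \<le> g x) \<Longrightarrow> infsum f A \<le> infsum g A"
  by (rule infsum_mono) (auto intro: ennreal_summable_on)

lemma infsum_ennreal_cmult:
  fixes f :: "'b \<Rightarrow> ennreal"
  shows "infsum (\<lambda>x. c * f x) A = c * infsum f A"
  by (simp add: nonneg_infsum_complete sum_distrib_left[symmetric] SUP_mult_left_ennreal)

text \<open>
  The value at index \<open>0\<close> has to stay \<open>0\<close>, since it stands for the convention \<open>t\<^sub>0 = 0\<close>.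
\<close>
definition delay :: "real \<Rightarrow> (nat \<Rightarrow> real) \<Rightarrow> nat \<Rightarrow> real" where
  "delay h \<sigma> k = (if k = 0 then 0 else \<sigma> k + h)"

definition prepend :: "real \<Rightarrow> (nat \<Rightarrow> real) \<Rightarrow> nat \<Rightarrow> real" where
  "prepend \<theta> \<sigma> k = (if k = 0 then 0 else \<sigma> (k - 1) + \<theta>)"

lemma delay_in_impulse_seqs:
  assumes "\<sigma> \<in> impulse_seqs" "0 \<le> h"
  shows "delay h \<sigma> \<in> impulse_seqs"
proof -
  have "filterlim (\<lambda>k. \<sigma> k + h) at_top sequentially"
    using assms by (auto simp: impulse_seqs_def intro: filterlim_at_top_mono)
  moreover have "eventually (\<lambda>k. \<sigma> k + h = delay h \<sigma> k) sequentially"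
    using eventually_gt_at_top[of 0] by eventually_elim (auto simp: delay_def)
  ultimately have "filterlim (delay h \<sigma>) at_top sequentially"
    by (simp add: filterlim_cong)
  moreover have "delay h \<sigma> k < delay h \<sigma> (k + 1)" for k
    using assms impulse_seqs_pos[OF assms(1), of 1] by (auto simp: delay_def impulse_seqs_def)
  ultimately show ?thesis by (auto simp: impulse_seqs_def delay_def)
qed

lemma prepend_in_impulse_seqs:
  assumes "\<sigma> \<in> impulse_seqs" "0 < \<theta>"
  shows "prepend \<theta> \<sigma> \<in> impulse_seqs"
proof -
  have "filterlim (\<lambda>k. \<sigma> k + \<theta>) at_top sequentially"
    using assms(1,2) by (auto simp: impulse_seqs_def intro: filterlim_at_top_mono)
  then have "filterlim (\<lambda>k. prepend \<theta> \<sigma> (Suc k)) at_top sequentially"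
    by (simp add: prepend_def)
  then have "filterlim (prepend \<theta> \<sigma>) at_top sequentially"
    by (simp only: filterlim_sequentially_Suc)
  moreover have "prepend \<theta> \<sigma> k < prepend \<theta> \<sigma> (k + 1)" for k
    using assms by (cases k) (auto simp: prepend_def impulse_seqs_def)
  ultimately show ?thesis by (auto simp: impulse_seqs_def prepend_def)
qed

context impulsive_flow
begin

text \<open>
  The two parts of \<open>trajectory_cost\<close>, with a free domain of integration and of summation, so that
  the cost can be cut at an intermediate time.
\<close>
definition flow_cost :: "real \<Rightarrow> (nat \<Rightarrow> real) \<Rightarrow> real \<Rightarrow> real set \<Rightarrow> 'a \<Rightarrow> ennreal" where
  "flow_cost p \<sigma> s I x = (\<integral>\<^sup>+t\<in>I. ennreal (norm (U S J \<sigma> t s x) powr p) \<partial>lborel)"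

definition jump_cost :: "real \<Rightarrow> (nat \<Rightarrow> real) \<Rightarrow> real \<Rightarrow> nat set \<Rightarrow> 'a \<Rightarrow> ennreal" where
  "jump_cost p \<sigma> s K x = (\<Sum>\<^sub>\<infinity>k\<in>K. ennreal (norm (U_left S J \<sigma> k s x) powr p))"

lemma trajectory_cost_eq:
  "trajectory_cost S J p \<sigma> s x = flow_cost p \<sigma> s {s..} x + jump_cost p \<sigma> s {k. 1 \<le> k \<and> s < \<sigma> k} x"
  by (simp add: trajectory_cost_def flow_cost_def jump_cost_def)

text \<open>
  The dynamic programming identity: from \<open>r\<close> on, the trajectory is the one that starts at \<open>r\<close> in the state
  reached there. An impulse exactly at \<open>r\<close> belongs to the first part, in agreement with \<open>U\<close>, which
  includes impulses at its final time and excludes those at its initial time.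
\<close>
lemma trajectory_cost_split:
  assumes "\<sigma> \<in> impulse_seqs" "0 < p" "s \<le> r"
  shows "trajectory_cost S J p \<sigma> s x =
    flow_cost p \<sigma> s {s..<r} x + jump_cost p \<sigma> s {k. 1 \<le> k \<and> s < \<sigma> k \<and> \<sigma> k \<le> r} x
    + trajectory_cost S J p \<sigma> r (U S J \<sigma> r s x)"
proof -
  let ?f = "\<lambda>t. ennreal (norm (U S J \<sigma> t s x) powr p)"
  have meas: "(\<lambda>t. ?f t * indicator I t) \<in> borel_measurable lborel"
    if "I \<in> sets borel" "I \<subseteq> {s..}" for I
  proof -
    have "(\<lambda>t. (?f t * indicator {s..} t) * indicator I t) \<in> borel_measurable borel"
      using that(1) by (intro borel_measurable_times_ennreal[OF measurable_U[OF assms(1,2)]]) auto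
    also have "(\<lambda>t. (?f t * indicator {s..} t) * indicator I t) = (\<lambda>t. ?f t * indicator I t)"
      using that(2) by (intro ext) (auto split: split_indicator)
    finally show ?thesis by (simp only: measurable_lborel2 measurable_lborel1)
  qed
  have "flow_cost p \<sigma> s {s..} x
      = (\<integral>\<^sup>+t. ?f t * indicator {s..<r} t + ?f t * indicator {r..} t \<partial>lborel)"
    unfolding flow_cost_def using assms(3)
    by (intro nn_integral_cong) (auto simp: indicator_def)
  also have "\<dots> = flow_cost p \<sigma> s {s..<r} x + flow_cost p \<sigma> s {r..} x"
    unfolding flow_cost_def using assms(3)
    by (intro nn_integral_add[OF meas meas]) auto
  also have "flow_cost p \<sigma> s {r..} x = flow_cost p \<sigma> r {r..} (U S J \<sigma> r s x)"
    unfolding flow_cost_def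
  proof (intro nn_integral_cong)
    fix t
    show "?f t * indicator {r..} t = ennreal (norm (U S J \<sigma> t r (U S J \<sigma> r s x)) powr p) * indicator {r..} t"
      using U_split[OF assms(1,3), of t] by (auto simp: indicator_def)
  qed
  finally have flow: "flow_cost p \<sigma> s {s..} x
      = flow_cost p \<sigma> s {s..<r} x + flow_cost p \<sigma> r {r..} (U S J \<sigma> r s x)" .
  have "{k. 1 \<le> k \<and> s < \<sigma> k}
      = {k. 1 \<le> k \<and> s < \<sigma> k \<and> \<sigma> k \<le> r} \<union> {k. 1 \<le> k \<and> r < \<sigma> k}"
    using assms(3) by auto
  then have "jump_cost p \<sigma> s {k. 1 \<le> k \<and> s < \<sigma> k} x
      = jump_cost p \<sigma> s {k. 1 \<le> k \<and> s < \<sigma> k \<and> \<sigma> k \<le> r} x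
        + jump_cost p \<sigma> s {k. 1 \<le> k \<and> r < \<sigma> k} x"
    unfolding jump_cost_def by (auto intro!: infsum_Un_disjoint ennreal_summable_on)
  also have "jump_cost p \<sigma> s {k. 1 \<le> k \<and> r < \<sigma> k} x
      = jump_cost p \<sigma> r {k. 1 \<le> k \<and> r < \<sigma> k} (U S J \<sigma> r s x)"
    unfolding jump_cost_def using U_left_split[OF assms(1,3)] by (intro infsum_cong) auto
  finally show ?thesis
    using flow by (simp add: trajectory_cost_eq ac_simps)
qed

text \<open>
  The sequence \<open>\<sigma>'\<close> reproduces \<open>\<sigma>\<close> after time \<open>r\<close>, with its first \<open>m\<close> impulses placed in \<open>(0, r]\<close>. The
  case \<open>m = 0\<close> covers delayed sequences and \<open>m = 1\<close> sequences with one impulse added in front.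
\<close>
lemma impulse_times_restart:
  assumes "\<sigma> \<in> impulse_seqs" "\<sigma>' \<in> impulse_seqs"
    and "\<And>k. 1 \<le> k \<Longrightarrow> \<sigma>' (k + m) = \<sigma> k + r" and "\<sigma>' m \<le> r"
  shows "{k. 1 \<le> k \<and> r < \<sigma>' k} = (\<lambda>k. k + m) ` {k. 1 \<le> k \<and> 0 < \<sigma> k}"
    and "impulse_times \<sigma>' \<inter> {r<..} = (\<lambda>a. a + r) ` impulse_times \<sigma>"
proof -
  have pos: "0 < \<sigma> k" if "1 \<le> k" for k
    using impulse_seqs_pos[OF assms(1) that] .
  have m_less: "m < k" if "r < \<sigma>' k" for k
    using strict_mono_less[OF impulse_seqs_strict_mono[OF assms(2)], of m k] that assms(4) by auto
  then have *: "\<exists>j. 1 \<le> j \<and> k = j + m" if "r < \<sigma>' k" for k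
    using m_less[OF that] by (intro exI[of _ "k - m"]) auto
  show 1: "{k. 1 \<le> k \<and> r < \<sigma>' k} = (\<lambda>k. k + m) ` {k. 1 \<le> k \<and> 0 < \<sigma> k}"
  proof (intro equalityI subsetI)
    fix k assume "k \<in> {k. 1 \<le> k \<and> r < \<sigma>' k}"
    then obtain j where "1 \<le> j" "k = j + m" using * by auto
    then show "k \<in> (\<lambda>k. k + m) ` {k. 1 \<le> k \<and> 0 < \<sigma> k}" using pos by auto
  qed (use pos assms(3) in auto)
  have "impulse_times \<sigma>' \<inter> {r<..} = \<sigma>' ` {k. 1 \<le> k \<and> r < \<sigma>' k}"
    by (auto simp: impulse_times_def)
  also have "\<dots> = (\<lambda>k. \<sigma> k + r) ` {k. 1 \<le> k \<and> 0 < \<sigma> k}"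
    unfolding 1 image_image by (intro image_cong) (use assms(3) in auto)
  also have "\<dots> = (\<lambda>a. a + r) ` impulse_times \<sigma>"
    using pos by (auto simp: impulse_times_def)
  finally show "impulse_times \<sigma>' \<inter> {r<..} = (\<lambda>a. a + r) ` impulse_times \<sigma>" .
qed

lemma flow_restart:
  assumes "impulse_times \<sigma>' \<inter> {r<..} = (\<lambda>a. a + r) ` impulse_times \<sigma>" "\<sigma> \<in> impulse_seqs"
    and "I \<subseteq> {0<..b}"
  shows "flow (t + r) r (impulse_times \<sigma>' \<inter> (\<lambda>a. a + r) ` I) = flow t 0 (impulse_times \<sigma> \<inter> I)"
proof -
  have "impulse_times \<sigma>' \<inter> (\<lambda>a. a + r) ` I = (impulse_times \<sigma>' \<inter> {r<..}) \<inter> (\<lambda>a. a + r) ` I"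
    using assms(3) by auto
  also have "\<dots> = (\<lambda>a. a + r) ` (impulse_times \<sigma> \<inter> I)"
    unfolding assms(1) by auto
  finally have *: "impulse_times \<sigma>' \<inter> (\<lambda>a. a + r) ` I = (\<lambda>a. a + r) ` (impulse_times \<sigma> \<inter> I)" .
  have "finite (impulse_times \<sigma> \<inter> I)"
    using assms(2,3) by (intro finite_impulse_times_upto[where b=b]) auto
  then show ?thesis
    using propagate_shift[of S J t r 0] by (simp add: * sorted_list_of_set_shift)
qed

text \<open>
  The propagator depends on differences of times only, so the cost from \<open>r\<close> on does not see what \<open>\<sigma>'\<close>
  did before.
\<close>
lemma trajectory_cost_restart:
  assumes "\<sigma> \<in> impulse_seqs" "\<sigma>' \<in> impulse_seqs" "0 < p"
    and "\<And>k. 1 \<le> k \<Longrightarrow> \<sigma>' (k + m) = \<sigma> k + r" and "\<sigma>' m \<le> r"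
  shows "trajectory_cost S J p \<sigma>' r x = trajectory_cost S J p \<sigma> 0 x"
proof -
  note times = impulse_times_restart[OF assms(1,2,4,5)]
  have U: "U S J \<sigma>' (t + r) r = U S J \<sigma> t 0" for t
  proof -
    have "(\<lambda>a. a + r) ` {0<..t} = {r<..t + r}"
      using image_add_greaterThanAtMost[of r 0 t] by (simp add: add.commute)
    then show ?thesis
      using flow_restart[OF times(2) assms(1), of "{0<..t}" t t] by (simp add: U_def)
  qed
  have U_left: "U_left S J \<sigma>' (k + m) r = U_left S J \<sigma> k 0" if "1 \<le> k" for k
  proof -
    have "(\<lambda>a. a + r) ` {0<..<\<sigma> k} = {r<..<\<sigma> k + r}"
    proof (intro equalityI subsetI)
      fix a assume "a \<in> {r<..<\<sigma> k + r}"
      then show "a \<in> (\<lambda>a. a + r) ` {0<..<\<sigma> k}" by (intro image_eqI[of _ _ "a - r"]) auto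
    qed auto
    moreover have "{0<..<\<sigma> k} \<subseteq> {0<..\<sigma> k}" by auto
    ultimately show ?thesis
      using flow_restart[OF times(2) assms(1), of "{0<..<\<sigma> k}" "\<sigma> k" "\<sigma> k"]
        that impulse_seqs_pos[OF assms(1) that] assms(1,2,4)
      by (auto simp: U_left_eq fun_eq_iff)
  qed
  have "flow_cost p \<sigma>' r {r..} x
      = (\<integral>\<^sup>+t. ennreal (norm (U S J \<sigma>' (r + 1 * t) r x) powr p) * indicator {r..} (r + 1 * t) \<partial>lborel)"
    unfolding flow_cost_def
    using nn_integral_real_affine[OF measurable_U[OF assms(2,3), of r x], of 1 r] by simp
  also have "\<dots> = flow_cost p \<sigma> 0 {0..} x"
    unfolding flow_cost_def by (intro nn_integral_cong) (auto simp: indicator_def U[symmetric] add.commute)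
  finally have flow: "flow_cost p \<sigma>' r {r..} x = flow_cost p \<sigma> 0 {0..} x" .
  have "jump_cost p \<sigma>' r {k. 1 \<le> k \<and> r < \<sigma>' k} x = jump_cost p \<sigma> 0 {k. 1 \<le> k \<and> 0 < \<sigma> k} x"
  proof -
    have "jump_cost p \<sigma>' r {k. 1 \<le> k \<and> r < \<sigma>' k} x
        = infsum ((\<lambda>k. ennreal (norm (U_left S J \<sigma>' k r x) powr p)) \<circ> (\<lambda>k. k + m)) {k. 1 \<le> k \<and> 0 < \<sigma> k}"
      unfolding jump_cost_def by (simp only: times(1)) (rule infsum_reindex, simp add: inj_on_def)
    also have "\<dots> = jump_cost p \<sigma> 0 {k. 1 \<le> k \<and> 0 < \<sigma> k} x"
      unfolding jump_cost_def by (intro infsum_cong) (auto simp: U_left)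
    finally show ?thesis .
  qed
  then show ?thesis using flow by (simp add: trajectory_cost_eq)
qed

lemma trajectory_cost_delay:
  assumes "\<sigma> \<in> impulse_seqs" "0 < p" "0 \<le> h"
  shows "trajectory_cost S J p (delay h \<sigma>) 0 x
    = (\<integral>\<^sup>+t\<in>{0..<h}. ennreal (norm (S t x) powr p) \<partial>lborel) + trajectory_cost S J p \<sigma> 0 (S h x)"
proof -
  have del: "delay h \<sigma> \<in> impulse_seqs" using assms by (intro delay_in_impulse_seqs)
  have late: "h < delay h \<sigma> k" if "1 \<le> k" for k
    using impulse_seqs_pos[OF assms(1) that] that by (auto simp: delay_def)
  have "U S J (delay h \<sigma>) t 0 = S t" if "t \<le> h" for t
  proof -
    have "impulse_times (delay h \<sigma>) \<inter> {0<..t} = {}"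
      using late that by (force simp: impulse_times_def)
    then show ?thesis by (simp add: U_no_impulse)
  qed
  moreover from this have "flow_cost p (delay h \<sigma>) 0 {0..<h} x
      = (\<integral>\<^sup>+t\<in>{0..<h}. ennreal (norm (S t x) powr p) \<partial>lborel)"
    unfolding flow_cost_def by (intro nn_integral_cong) (auto simp: indicator_def)
  moreover have none: "{k. 1 \<le> k \<and> 0 < delay h \<sigma> k \<and> delay h \<sigma> k \<le> h} = {}"
    using late not_le by blast
  moreover have "trajectory_cost S J p (delay h \<sigma>) h (S h x) = trajectory_cost S J p \<sigma> 0 (S h x)"
    by (rule trajectory_cost_restart[where m=0]) (use assms del in \<open>auto simp: delay_def\<close>)
  ultimately show ?thesis
    using trajectory_cost_split[OF del assms(2,3), of x, unfolded none] by (simp add: jump_cost_def)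
qed

lemma trajectory_cost_prepend:
  assumes "\<sigma> \<in> impulse_seqs" "0 < p" "0 < \<theta>"
  shows "ennreal (norm (S \<theta> x) powr p) + trajectory_cost S J p \<sigma> 0 (J (S \<theta> x))
    \<le> trajectory_cost S J p (prepend \<theta> \<sigma>) 0 x"
proof -
  let ?\<sigma> = "prepend \<theta> \<sigma>"
  have pre: "?\<sigma> \<in> impulse_seqs" using assms by (intro prepend_in_impulse_seqs)
  have first: "?\<sigma> 1 = \<theta>" using assms(1) by (simp add: prepend_def impulse_seqs_def)
  have late: "\<theta> < ?\<sigma> k \<longleftrightarrow> 1 < k" "\<theta> \<le> ?\<sigma> k \<longleftrightarrow> 1 \<le> k" for k
    using strict_mono_less[OF impulse_seqs_strict_mono[OF pre], of 1 k]
     strict_mono_less_eq[OF impulse_seqs_strict_mono[OF pre], of 1 k] first by auto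
  have "impulse_times ?\<sigma> \<inter> {0<..\<theta>} = {\<theta>}"
  proof (intro equalityI subsetI)
    fix a assume "a \<in> impulse_times ?\<sigma> \<inter> {0<..\<theta>}"
    then obtain k where "1 \<le> k" "a = ?\<sigma> k" "?\<sigma> k \<le> \<theta>" by (auto simp: impulse_times_def)
    then show "a \<in> {\<theta>}" using late(2)[of k] by auto
  qed (use first assms(3) in \<open>auto simp: impulse_times_def intro!: image_eqI[of _ _ 1]\<close>)
  then have U: "U S J ?\<sigma> \<theta> 0 x = J (S \<theta> x)" by (simp add: U_def)
  have "impulse_times ?\<sigma> \<inter> {0<..<\<theta>} = {}"
    using late(2) by (auto simp: impulse_times_def) (metis One_nat_def leD)
  then have U_left: "U_left S J ?\<sigma> 1 0 x = S \<theta> x"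
    using first assms(3) pre by (subst U_left_eq) auto
  have one: "{k. 1 \<le> k \<and> 0 < ?\<sigma> k \<and> ?\<sigma> k \<le> \<theta>} = {1}"
  proof (intro equalityI subsetI)
    fix k assume "k \<in> {k. 1 \<le> k \<and> 0 < ?\<sigma> k \<and> ?\<sigma> k \<le> \<theta>}"
    then show "k \<in> {1}" using late(1)[of k] by auto
  qed (use first assms(3) in auto)
  have "trajectory_cost S J p ?\<sigma> \<theta> (J (S \<theta> x)) = trajectory_cost S J p \<sigma> 0 (J (S \<theta> x))"
    by (rule trajectory_cost_restart[where m=1])
      (use assms pre first in \<open>auto simp: prepend_def\<close>)
  then show ?thesis
    using trajectory_cost_split[OF pre assms(2) less_imp_le[OF assms(3)], of x, unfolded one U] U_left
    by (simp add: jump_cost_def add_right_mono)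
qed

end

section \<open>Costs of decaying trajectories\<close>

text \<open>
  The mean value theorem for \<open>z \<mapsto> z\<^sup>p\<close>, on the interval between \<open>b\<close> and \<open>a\<close>.
\<close>
lemma powr_le_powr_add:
  fixes a b p R :: real
  assumes "0 \<le> a" "0 \<le> b" "a \<le> R" "1 \<le> p"
  shows "a powr p \<le> b powr p + p * R powr (p - 1) * \<bar>a - b\<bar>"
proof (cases "a \<le> b")
  case True
  then show ?thesis using assms powr_mono2[of p a b] by (simp add: add_increasing2)
next
  case False
  have "\<exists>l z. b < z \<and> z < a \<and> DERIV (\<lambda>z. z powr p) z :> l \<and> a powr p - b powr p = (a - b) * l"
  proof (rule MVT)
    show "continuous_on {b..a} (\<lambda>z. z powr p)"
      using assms by (intro continuous_on_powr' continuous_intros) auto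
    show "(\<lambda>z. z powr p) differentiable (at z)" if "b < z" "z < a" for z
      using has_real_derivative_powr[of z p] that assms real_differentiable_def by auto
  qed (use False in simp)
  then obtain l z where z: "b < z" "z < a" "DERIV (\<lambda>z. z powr p) z :> l"
    "a powr p - b powr p = (a - b) * l" by blast
  have "l = p * z powr (p - 1)"
    using z assms by (intro DERIV_unique[OF z(3)] has_real_derivative_powr) auto
  also have "\<dots> \<le> p * R powr (p - 1)"
    using z assms by (intro mult_left_mono powr_mono2) auto
  finally have "(a - b) * l \<le> (a - b) * (p * R powr (p - 1))"
    using False by (intro mult_left_mono) auto
  then show ?thesis using z(4) False by (simp add: algebra_simps)
qed

text \<open>
  This makes the \<open>p\<close>-th power of the norm of a state Lipschitz in the initial value, with a constant
  proportional to \<open>K\<^sup>p\<close>. When the propagator decays, these constants can be summed over a trajectory.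
\<close>
lemma norm_powr_blinfun_le:
  fixes T :: "'a::real_normed_vector \<Rightarrow>\<^sub>L 'b::real_normed_vector"
  assumes "norm T \<le> K" "norm x \<le> r" "1 \<le> p"
  shows "norm (T x) powr p \<le> norm (T y) powr p + p * r powr (p - 1) * norm (x - y) * K powr p"
proof -
  have K: "0 \<le> K" using assms(1) norm_ge_zero[of T] by linarith
  have r: "0 \<le> r" using assms(2) norm_ge_zero[of x] by linarith
  have bound: "norm (T z) \<le> K * norm z" for z
    using norm_blinfun[of T z] assms(1) by (meson mult_right_mono norm_ge_zero order_trans)
  have "norm (T x) \<le> K * r"
    using bound[of x] assms(2) K by (meson mult_left_mono order_trans)
  then have "norm (T x) powr p
      \<le> norm (T y) powr p + p * (K * r) powr (p - 1) * \<bar>norm (T x) - norm (T y)\<bar>"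
    using assms(3) by (intro powr_le_powr_add) auto
  also have "\<bar>norm (T x) - norm (T y)\<bar> \<le> K * norm (x - y)"
    using norm_triangle_ineq3[of "T x" "T y"] bound[of "x - y"] by (simp add: blinfun.diff_right)
  also have "p * (K * r) powr (p - 1) * (K * norm (x - y))
      = p * r powr (p - 1) * norm (x - y) * (K powr (p - 1) * K)"
    using K r by (simp add: powr_mult)
  also have "K powr (p - 1) * K = K powr p"
    using K by (cases "K = 0") (auto simp: powr_diff)
  finally show ?thesis using assms(3) by (simp add: mult_left_mono)
qed

lemma nn_integral_exp_decay:
  fixes \<beta> s :: real
  assumes "0 < \<beta>"
  shows "(\<integral>\<^sup>+t\<in>{s..}. ennreal (exp (- \<beta> * (t - s))) \<partial>lborel) = ennreal (1 / \<beta>)"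
proof -
  have "filterlim (\<lambda>t. - s + t) at_top at_top"
    by (rule filterlim_tendsto_add_at_top[OF tendsto_const filterlim_ident])
  from filterlim_tendsto_pos_mult_at_top[OF tendsto_const assms this]
  have "filterlim (\<lambda>t. \<beta> * (t - s)) at_top at_top" by simp
  then have "((\<lambda>t. exp (- (\<beta> * (t - s)))) \<longlongrightarrow> 0) at_top"
    by (intro filterlim_compose[OF exp_at_bot] filterlim_compose[OF filterlim_uminus_at_bot_at_top])
  then have "((\<lambda>t. - exp (- \<beta> * (t - s)) / \<beta>) \<longlongrightarrow> - 0 / \<beta>) at_top"
    by (intro tendsto_intros) (use assms in auto)
  then have "(\<integral>\<^sup>+t\<in>{s..}. ennreal (exp (- \<beta> * (t - s))) \<partial>lborel)
      = 0 - (- exp (- \<beta> * (s - s)) / \<beta>)"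
    using assms by (intro nn_integral_FTC_atLeast) (auto intro!: derivative_eq_intros)
  then show ?thesis by simp
qed

context impulsive_flow
begin

text \<open>The estimate in \<open>strongly_UGES\<close>, restricted to a single sequence and a single initial time.\<close>
definition decays_from :: "real \<Rightarrow> real \<Rightarrow> real \<Rightarrow> (nat \<Rightarrow> real) \<Rightarrow> real \<Rightarrow> bool" where
  "decays_from M \<alpha> \<rho> \<sigma> s \<longleftrightarrow>
     (\<forall>t\<ge>s. norm (U S J \<sigma> t s) \<le> M * \<rho> ^ \<kappa> \<sigma> t s * exp (- \<alpha> * (t - s)))"

context
  fixes M \<alpha> \<rho> p :: real and \<sigma> :: "nat \<Rightarrow> real" and s :: real
  assumes M: "1 \<le> M" and \<alpha>: "0 < \<alpha>" and \<rho>: "0 < \<rho>" "\<rho> < 1" and p: "1 \<le> p"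
    and \<sigma>: "\<sigma> \<in> impulse_seqs" and decay: "decays_from M \<alpha> \<rho> \<sigma> s"
begin

abbreviation "impulses_before k \<equiv> impulse_times \<sigma> \<inter> {s<..<\<sigma> k}"

lemma finite_impulses_before: "finite (impulses_before k)"
  by (rule finite_impulse_times_upto[OF \<sigma>, of _ "\<sigma> k"]) auto

lemma U_decay:
  assumes "s \<le> t"
  shows "norm (U S J \<sigma> t s) \<le> M * exp (- \<alpha> * (t - s))"
proof -
  have "norm (U S J \<sigma> t s) \<le> M * \<rho> ^ \<kappa> \<sigma> t s * exp (- \<alpha> * (t - s))"
    using decay assms by (simp add: decays_from_def)
  also have "\<dots> \<le> M * 1 * exp (- \<alpha> * (t - s))"
    using M \<rho> by (intro mult_right_mono mult_left_mono power_le_one) auto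
  finally show ?thesis by simp
qed

text \<open>
  Here \<open>impulses_before k\<close> leaves out the impulse at \<open>\<sigma> k\<close> itself: the bound is inherited from times
  shortly before \<open>\<sigma> k\<close>, where that impulse has not yet been counted.
\<close>
lemma U_left_decay:
  assumes "s < \<sigma> k"
  shows "norm (flow (\<sigma> k) s (impulses_before k)) \<le> M * \<rho> ^ card (impulses_before k)"
proof (rule norm_blinfun_bound)
  fix x
  let ?A = "impulses_before k"
  define r where "r = Max (insert s ?A)"
  have r: "s \<le> r" "\<And>a. a \<in> ?A \<Longrightarrow> a \<le> r" "r < \<sigma> k"
    using finite_impulses_before assms by (auto simp: r_def)
  have "eventually (\<lambda>t. norm (U S J \<sigma> t s x) \<le> M * \<rho> ^ card ?A * norm x) (at_left (\<sigma> k))"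
    unfolding eventually_at_left_field
  proof (intro exI[of _ r] conjI allI impI r(3))
    fix t assume t: "r < t" "t < \<sigma> k"
    have "impulse_times \<sigma> \<inter> {s<..t} = ?A"
    proof (intro equalityI subsetI)
      fix a assume "a \<in> ?A"
      then show "a \<in> impulse_times \<sigma> \<inter> {s<..t}" using r(2)[of a] t by auto
    qed (use t in auto)
    then have "\<kappa> \<sigma> t s = card ?A" by (simp add: \<kappa>_def)
    then have "norm (U S J \<sigma> t s) \<le> M * \<rho> ^ card ?A * exp (- \<alpha> * (t - s))"
      using decay[unfolded decays_from_def, rule_format, of t] t r(1) by simp
    also have "\<dots> \<le> M * \<rho> ^ card ?A * 1"
      using t r(1) \<alpha> M \<rho> by (intro mult_left_mono) auto
    finally have "norm (U S J \<sigma> t s) \<le> M * \<rho> ^ card ?A" by simp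
    then show "norm (U S J \<sigma> t s x) \<le> M * \<rho> ^ card ?A * norm x"
      using norm_blinfun[of "U S J \<sigma> t s" x] by (meson mult_right_mono norm_ge_zero order_trans)
  qed
  moreover have "((\<lambda>t. norm (U S J \<sigma> t s x)) \<longlongrightarrow> norm (flow (\<sigma> k) s ?A x)) (at_left (\<sigma> k))"
    using U_tendsto_left[OF \<sigma> assms] by (rule tendsto_norm)
  ultimately show "norm (flow (\<sigma> k) s ?A x) \<le> M * \<rho> ^ card ?A * norm x"
    by (intro tendsto_upperbound) auto
qed (use M \<rho> in auto)

text \<open>
  The number of impulses before \<open>\<sigma> k\<close> is strictly increasing in \<open>k\<close>, so the terms are distinct members
  of a geometric series.
\<close>
lemma jump_weights_le:
  "(\<Sum>\<^sub>\<infinity>k\<in>{k. 1 \<le> k \<and> s < \<sigma> k}. ennreal ((M * \<rho> ^ card (impulses_before k)) powr p))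
    \<le> ennreal (M powr p / (1 - \<rho> powr p))"
proof -
  define q where "q = \<rho> powr p"
  have q: "0 < q" "q < 1"
    using \<rho> p powr_less_mono2[of p \<rho> 1] by (auto simp: q_def)
  let ?K = "{k. 1 \<le> k \<and> s < \<sigma> k}"
  let ?n = "\<lambda>k. card (impulses_before k)"
  have "?n j < ?n k" if "j \<in> ?K" "j < k" for j k
  proof (rule psubset_card_mono[OF finite_impulses_before])
    have "\<sigma> j < \<sigma> k" using strict_monoD[OF impulse_seqs_strict_mono[OF \<sigma>] that(2)] .
    then have "\<sigma> j \<in> impulses_before k - impulses_before j" "impulses_before j \<subseteq> impulses_before k"
      using that(1) by (auto simp: impulse_times_def)
    then show "impulses_before j \<subset> impulses_before k" by blast
  qed
  then have inj: "inj_on ?n ?K"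
    by (intro linorder_inj_onI) (auto simp: less_imp_neq)
  have eq: "(M * \<rho> ^ n) powr p = M powr p * q ^ n" for n
    using M \<rho> by (simp add: q_def powr_mult powr_realpow[symmetric] powr_powr mult.commute)
  have "(\<Sum>k\<in>F. ennreal ((M * \<rho> ^ ?n k) powr p)) \<le> ennreal (M powr p / (1 - q))"
    if "finite F" "F \<subseteq> ?K" for F
  proof -
    have "(\<Sum>k\<in>F. q ^ ?n k) = (\<Sum>n\<in>?n ` F. q ^ n)"
      using inj that by (subst sum.reindex) (auto intro: inj_on_subset)
    also have "\<dots> \<le> (\<Sum>n. q ^ n)"
      using that q by (intro sum_le_suminf summable_geometric) auto
    also have "\<dots> = 1 / (1 - q)"
      using q by (intro suminf_geometric) auto
    finally have "M powr p * (\<Sum>k\<in>F. q ^ ?n k) \<le> M powr p * (1 / (1 - q))"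
      by (rule mult_left_mono) simp
    then have "(\<Sum>k\<in>F. (M * \<rho> ^ ?n k) powr p) \<le> M powr p / (1 - q)"
      by (simp add: eq sum_distrib_left)
    then show ?thesis by (subst sum_ennreal) (auto intro: ennreal_leI)
  qed
  then show ?thesis
    unfolding q_def by (subst nonneg_infsum_complete) (auto intro!: SUP_least)
qed

lemma flow_weights:
  "(\<integral>\<^sup>+t\<in>{s..}. ennreal ((M * exp (- \<alpha> * (t - s))) powr p) \<partial>lborel) = ennreal (M powr p / (\<alpha> * p))"
proof -
  have "(\<integral>\<^sup>+t\<in>{s..}. ennreal ((M * exp (- \<alpha> * (t - s))) powr p) \<partial>lborel)
      = (\<integral>\<^sup>+t. ennreal (M powr p) * (ennreal (exp (- (\<alpha> * p) * (t - s))) * indicator {s..} t) \<partial>lborel)"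
    using M by (intro nn_integral_cong)
      (auto simp: indicator_def powr_mult exp_powr_real ennreal_mult algebra_simps)
  also have "\<dots> = ennreal (M powr p) * ennreal (1 / (\<alpha> * p))"
    using \<alpha> p by (subst nn_integral_cmult, measurable) (subst nn_integral_exp_decay, auto)
  finally show ?thesis using \<alpha> p by (simp add: ennreal_mult[symmetric])
qed

text \<open>
  Comparing with \<open>y = 0\<close> also gives the bound on the cost itself.
\<close>
lemma trajectory_cost_lipschitz:
  assumes "norm x \<le> r"
  shows "trajectory_cost S J p \<sigma> s x \<le> trajectory_cost S J p \<sigma> s y
    + ennreal (p * r powr (p - 1) * (M powr p / (\<alpha> * p) + M powr p / (1 - \<rho> powr p)) * norm (x - y))"
proof -
  define d where "d = p * r powr (p - 1) * norm (x - y)"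
  have d: "0 \<le> d" using p by (simp add: d_def)
  let ?w = "\<lambda>t. (M * exp (- \<alpha> * (t - s))) powr p"
  let ?v = "\<lambda>k. (M * \<rho> ^ card (impulses_before k)) powr p"
  let ?K = "{k. 1 \<le> k \<and> s < \<sigma> k}"
  have "ennreal (norm (U S J \<sigma> t s x) powr p) * indicator {s..} t
      \<le> ennreal (norm (U S J \<sigma> t s y) powr p) * indicator {s..} t + ennreal d * (ennreal (?w t) * indicator {s..} t)" for t
    using norm_powr_blinfun_le[OF U_decay assms p, of t y] d
    by (auto simp: indicator_def d_def ennreal_mult[symmetric] ennreal_plus[symmetric]
        simp del: ennreal_plus intro!: ennreal_leI)
  then have "flow_cost p \<sigma> s {s..} x
      \<le> (\<integral>\<^sup>+t. ennreal (norm (U S J \<sigma> t s y) powr p) * indicator {s..} t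
            + ennreal d * (ennreal (?w t) * indicator {s..} t) \<partial>lborel)"
    unfolding flow_cost_def by (rule nn_integral_mono)
  also have "\<dots> = flow_cost p \<sigma> s {s..} y + (\<integral>\<^sup>+t. ennreal d * (ennreal (?w t) * indicator {s..} t) \<partial>lborel)"
  proof -
    have "(\<lambda>t. ennreal (norm (U S J \<sigma> t s y) powr p) * indicator {s..} t) \<in> borel_measurable lborel"
      using measurable_U[OF \<sigma>, of p s y] p by (simp only: measurable_lborel2 measurable_lborel1)
    then show ?thesis unfolding flow_cost_def by (intro nn_integral_add) auto
  qed
  also have "(\<integral>\<^sup>+t. ennreal d * (ennreal (?w t) * indicator {s..} t) \<partial>lborel)
      = ennreal d * ennreal (M powr p / (\<alpha> * p))"
    by (subst nn_integral_cmult, measurable) (simp only: flow_weights)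
  finally have flow: "flow_cost p \<sigma> s {s..} x
      \<le> flow_cost p \<sigma> s {s..} y + ennreal d * ennreal (M powr p / (\<alpha> * p))" .
  have "ennreal (norm (U_left S J \<sigma> k s x) powr p)
      \<le> ennreal (norm (U_left S J \<sigma> k s y) powr p) + ennreal d * ennreal (?v k)" if "k \<in> ?K" for k
    using norm_powr_blinfun_le[OF U_left_decay assms p, of k y] d that \<sigma>
    by (auto simp: U_left_eq d_def ennreal_mult[symmetric] ennreal_plus[symmetric]
        simp del: ennreal_plus intro!: ennreal_leI)
  then have "jump_cost p \<sigma> s ?K x
      \<le> (\<Sum>\<^sub>\<infinity>k\<in>?K. ennreal (norm (U_left S J \<sigma> k s y) powr p) + ennreal d * ennreal (?v k))"
    unfolding jump_cost_def by (rule infsum_ennreal_mono)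
  also have "\<dots> = jump_cost p \<sigma> s ?K y + ennreal d * (\<Sum>\<^sub>\<infinity>k\<in>?K. ennreal (?v k))"
    unfolding jump_cost_def by (simp add: infsum_add ennreal_summable_on infsum_ennreal_cmult)
  also have "\<dots> \<le> jump_cost p \<sigma> s ?K y + ennreal d * ennreal (M powr p / (1 - \<rho> powr p))"
    by (intro add_left_mono mult_left_mono jump_weights_le) auto
  finally have "trajectory_cost S J p \<sigma> s x
      \<le> (flow_cost p \<sigma> s {s..} y + ennreal d * ennreal (M powr p / (\<alpha> * p)))
        + (jump_cost p \<sigma> s ?K y + ennreal d * ennreal (M powr p / (1 - \<rho> powr p)))"
    unfolding trajectory_cost_eq using flow by (rule add_mono[rotated])
  also have "\<dots> = trajectory_cost S J p \<sigma> s y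
      + ennreal (d * (M powr p / (\<alpha> * p) + M powr p / (1 - \<rho> powr p)))"
  proof -
    have "0 \<le> M powr p / (\<alpha> * p)" "0 \<le> M powr p / (1 - \<rho> powr p)"
      using \<alpha> \<rho> p powr_less_mono2[of p \<rho> 1] by auto
    then have "ennreal (d * (M powr p / (\<alpha> * p) + M powr p / (1 - \<rho> powr p)))
        = ennreal d * ennreal (M powr p / (\<alpha> * p)) + ennreal d * ennreal (M powr p / (1 - \<rho> powr p))"
      using d by (simp only: distrib_left[symmetric] ennreal_plus[symmetric] ennreal_mult add_nonneg_nonneg)
    then show ?thesis by (simp only: trajectory_cost_eq ac_simps)
  qed
  finally show ?thesis by (simp add: d_def ac_simps)
qed

end

lemma trajectory_cost_0: "\<sigma> \<in> impulse_seqs \<Longrightarrow> trajectory_cost S J p \<sigma> s 0 = 0"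
  unfolding trajectory_cost_eq flow_cost_def jump_cost_def
  by (auto simp: U_left_eq intro!: infsum_0)

end

section \<open>The supremum of the costs as a Lyapunov functional\<close>

lemma S_clock_impulse_seqs: "\<sigma> \<in> S_clock T \<tau> \<Longrightarrow> \<sigma> \<in> impulse_seqs"
  by (auto simp: S_clock_def)

lemma S_min_impulse_seqs: "\<sigma> \<in> S_min T \<Longrightarrow> \<sigma> \<in> impulse_seqs"
  by (auto simp: S_min_def)

text \<open>
  At the clock value \<open>0\<close> a full dwell time has to pass before the first impulse.
\<close>
lemma S_min_eq_S_clock_0:
  assumes "0 < T"
  shows "S_min T = S_clock T 0"
proof -
  have "(\<forall>k. T \<le> \<sigma> (k + 1) - \<sigma> k) \<longleftrightarrow> T \<le> \<sigma> 1 \<and> (\<forall>k\<ge>1. T \<le> \<sigma> (k + 1) - \<sigma> k)"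
    if "\<sigma> \<in> impulse_seqs" for \<sigma>
  proof -
    have "\<sigma> 0 = 0" using that by (simp add: impulse_seqs_def)
    then show ?thesis
      by (metis add_0 diff_zero less_one not_less)
  qed
  then show ?thesis using assms by (auto simp: S_min_def S_clock_def)
qed

lemma S_clock_mono: "\<tau> \<le> \<tau>' \<Longrightarrow> S_clock T \<tau> \<subseteq> S_clock T \<tau>'"
  by (auto simp: S_clock_def min_def max_def split: if_splits)

lemma exists_S_min:
  assumes "0 < T"
  obtains \<sigma> where "\<sigma> \<in> S_min T" "b < \<sigma> 1"
proof -
  define d where "d = max T b + 1"
  have "filterlim (\<lambda>k. d * real k) at_top sequentially"
    using assms by (intro filterlim_tendsto_pos_mult_at_top[OF tendsto_const])
      (auto simp: d_def filterlim_real_sequentially)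
  then have "(\<lambda>k. d * real k) \<in> S_min T"
    using assms by (auto simp: S_min_def impulse_seqs_def d_def algebra_simps)
  then show thesis by (rule that) (simp add: d_def)
qed

text \<open>
  A delay by \<open>T\<close> makes any first impulse admissible. This transports estimates for \<open>S_min T\<close>, started at
  time \<open>T\<close>, to the clock classes.
\<close>
lemma delay_in_S_min:
  assumes "0 < T" "\<sigma> \<in> S_clock T \<tau>"
  shows "delay T \<sigma> \<in> S_min T"
proof -
  have "T \<le> delay T \<sigma> (k + 1) - delay T \<sigma> k" for k
    using assms impulse_seqs_pos[of \<sigma> 1] by (cases k) (auto simp: delay_def S_clock_def)
  then show ?thesis
    using assms delay_in_impulse_seqs[of \<sigma> T] S_clock_impulse_seqs by (auto simp: S_min_def)
qed

text \<open>
  A clock that shows \<open>\<tau>\<close> now shows \<open>\<tau> + h\<close> after free flow of duration \<open>h\<close>.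
\<close>
lemma delay_in_S_clock:
  assumes "\<sigma> \<in> S_clock T (\<tau> + h)" "0 \<le> h"
  shows "delay h \<sigma> \<in> S_clock T \<tau>"
proof -
  have "max (T - min \<tau> T) 0 \<le> delay h \<sigma> 1"
    using assms by (auto simp: delay_def S_clock_def min_def max_def split: if_splits)
  moreover have "T \<le> delay h \<sigma> (k + 1) - delay h \<sigma> k" if "1 \<le> k" for k
    using assms that by (auto simp: delay_def S_clock_def)
  ultimately show ?thesis
    using assms delay_in_impulse_seqs[of \<sigma> h] by (auto simp: S_clock_def)
qed

lemma prepend_gap:
  assumes "\<sigma> \<in> S_min T" "1 \<le> k"
  shows "T \<le> prepend \<theta> \<sigma> (k + 1) - prepend \<theta> \<sigma> k"
  using assms by (cases k) (auto simp: prepend_def S_min_def)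

lemma prepend_first: "\<sigma> \<in> impulse_seqs \<Longrightarrow> prepend \<theta> \<sigma> 1 = \<theta>"
  by (simp add: prepend_def impulse_seqs_def)

lemma prepend_in_S_clock:
  assumes "\<sigma> \<in> S_min T" "0 < \<theta>"
  shows "prepend \<theta> \<sigma> \<in> S_clock T T"
  using assms prepend_gap[OF assms(1)] prepend_in_impulse_seqs[of \<sigma> \<theta>] prepend_first[of \<sigma> \<theta>]
    S_min_impulse_seqs[OF assms(1)]
  by (auto simp: S_clock_def)

lemma prepend_in_S_min:
  assumes "\<sigma> \<in> S_min T" "0 < T" "T \<le> \<theta>"
  shows "prepend \<theta> \<sigma> \<in> S_min T"
  using assms prepend_gap[OF assms(1)] prepend_in_impulse_seqs[of \<sigma> \<theta>] prepend_first[of \<sigma> \<theta>]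
    S_min_impulse_seqs[OF assms(1)]
  unfolding S_min_eq_S_clock_0[OF assms(2)] by (auto simp: S_clock_def)

context impulsive_flow
begin

text \<open>
  The class \<open>S_clock T \<tau>\<close> on the right may be that of a clock that has run out, where \<open>\<theta>\<close> is arbitrary, or
  \<open>S_min T\<close> itself, where \<open>\<theta> \<ge> T\<close> is required.
\<close>
lemma V_sup_prepend:
  assumes "0 < T" "0 < p" "0 < \<theta>" "\<And>\<sigma>. \<sigma> \<in> S_min T \<Longrightarrow> prepend \<theta> \<sigma> \<in> S_clock T \<tau>"
  shows "ennreal (norm (S \<theta> x) powr p) + V_sup S J T p 0 (J (S \<theta> x)) \<le> V_sup S J T p \<tau> x"
proof -
  have "S_min T \<noteq> {}" using exists_S_min[OF assms(1)] by blast
  then have "ennreal (norm (S \<theta> x) powr p) + V_sup S J T p 0 (J (S \<theta> x))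
      = (SUP \<sigma>\<in>S_min T. ennreal (norm (S \<theta> x) powr p) + trajectory_cost S J p \<sigma> 0 (J (S \<theta> x)))"
    unfolding V_sup_def S_min_eq_S_clock_0[OF assms(1), symmetric] by (rule ennreal_SUP_add_right)
  also have "\<dots> \<le> V_sup S J T p \<tau> x"
  proof (rule SUP_least)
    fix \<sigma> assume \<sigma>: "\<sigma> \<in> S_min T"
    then have "ennreal (norm (S \<theta> x) powr p) + trajectory_cost S J p \<sigma> 0 (J (S \<theta> x))
        \<le> trajectory_cost S J p (prepend \<theta> \<sigma>) 0 x"
      using assms by (intro trajectory_cost_prepend S_min_impulse_seqs) auto
    also have "\<dots> \<le> V_sup S J T p \<tau> x"
      unfolding V_sup_def using assms(4)[OF \<sigma>] by (rule SUP_upper)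
    finally show "ennreal (norm (S \<theta> x) powr p) + trajectory_cost S J p \<sigma> 0 (J (S \<theta> x))
        \<le> V_sup S J T p \<tau> x" .
  qed
  finally show ?thesis .
qed

text \<open>Strong UGES over \<open>S_min T\<close>, with fixed constants, on which the bounds for \<open>V_sup\<close> depend explicitly.\<close>

context
  fixes M \<alpha> \<rho> p T :: real
  assumes M: "1 \<le> M" and \<alpha>: "0 < \<alpha>" and \<rho>: "0 < \<rho>" "\<rho> < 1" and p: "1 \<le> p" and T: "0 < T"
    and decay: "\<And>\<sigma> s. \<sigma> \<in> S_min T \<Longrightarrow> 0 \<le> s \<Longrightarrow> decays_from M \<alpha> \<rho> \<sigma> s"
begin

text \<open>
  The factor \<open>p\<close> comes from the derivative of \<open>z \<mapsto> z\<^sup>p\<close>, the two summands from the integral of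
  \<open>exp (- \<alpha> p t)\<close> and the geometric series with ratio \<open>\<rho>\<^sup>p\<close>.
\<close>
definition "cost_const = p * (M powr p / (\<alpha> * p) + M powr p / (1 - \<rho> powr p))"

lemma cost_const_pos: "0 < cost_const"
proof -
  have "0 < M powr p / (\<alpha> * p)" "0 \<le> M powr p / (1 - \<rho> powr p)"
    using M \<alpha> \<rho> p powr_less_mono2[of p \<rho> 1] by auto
  then show ?thesis using p by (simp add: cost_const_def add_pos_nonneg)
qed

lemma S_min_cost_lipschitz:
  assumes "\<sigma> \<in> S_min T" "0 \<le> s" "norm x \<le> r"
  shows "trajectory_cost S J p \<sigma> s x
    \<le> trajectory_cost S J p \<sigma> s y + ennreal (cost_const * r powr (p - 1) * norm (x - y))"
  using trajectory_cost_lipschitz[OF M \<alpha> \<rho> p _ decay[OF assms(1,2)] assms(3), of y] assms(1) S_min_impulse_seqs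
  by (simp add: cost_const_def ac_simps)

lemma S_min_cost_le:
  assumes "\<sigma> \<in> S_min T" "0 \<le> s"
  shows "trajectory_cost S J p \<sigma> s x \<le> ennreal (cost_const * norm x powr p)"
proof -
  have "norm x powr (p - 1) * norm x = norm x powr p"
    by (cases "x = 0") (auto simp: powr_diff)
  then show ?thesis
    using S_min_cost_lipschitz[OF assms order_refl, of x 0] S_min_impulse_seqs[OF assms(1)]
    by (simp add: trajectory_cost_0 mult.assoc)
qed

lemma cost_S_clock:
  assumes "\<sigma> \<in> S_clock T \<tau>"
  shows "trajectory_cost S J p \<sigma> 0 x = trajectory_cost S J p (delay T \<sigma>) T x"
  by (rule trajectory_cost_restart[where m=0, symmetric])
    (use S_clock_impulse_seqs[OF assms] S_min_impulse_seqs[OF delay_in_S_min[OF T assms]] p T in \<open>auto simp: delay_def\<close>)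

lemma V_sup_le: "V_sup S J T p \<tau> x \<le> ennreal (cost_const * norm x powr p)"
  unfolding V_sup_def
proof (rule SUP_least)
  fix \<sigma> assume "\<sigma> \<in> S_clock T \<tau>"
  then show "trajectory_cost S J p \<sigma> 0 x \<le> ennreal (cost_const * norm x powr p)"
    using S_min_cost_le[OF delay_in_S_min[OF T], of \<sigma> \<tau> T x] T by (simp add: cost_S_clock)
qed

lemma V_sup_lipschitz:
  assumes "norm x \<le> r"
  shows "V_sup S J T p \<tau> x
    \<le> V_sup S J T p \<tau> y + ennreal (cost_const * r powr (p - 1) * norm (x - y))"
  unfolding V_sup_def
proof (rule SUP_least)
  fix \<sigma> assume \<sigma>: "\<sigma> \<in> S_clock T \<tau>"
  have "trajectory_cost S J p \<sigma> 0 x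
      \<le> trajectory_cost S J p \<sigma> 0 y + ennreal (cost_const * r powr (p - 1) * norm (x - y))"
    using S_min_cost_lipschitz[OF delay_in_S_min[OF T \<sigma>] _ assms, of T y] T
    by (simp add: cost_S_clock[OF \<sigma>])
  also have "\<dots> \<le> (SUP \<sigma>\<in>S_clock T \<tau>. trajectory_cost S J p \<sigma> 0 y)
      + ennreal (cost_const * r powr (p - 1) * norm (x - y))"
    using \<sigma> by (intro add_right_mono SUP_upper)
  finally show "trajectory_cost S J p \<sigma> 0 x \<le> (SUP \<sigma>\<in>S_clock T \<tau>. trajectory_cost S J p \<sigma> 0 y)
      + ennreal (cost_const * r powr (p - 1) * norm (x - y))" .
qed

abbreviation "V \<tau> x \<equiv> enn2real (V_sup S J T p \<tau> x)"

lemma V_sup_finite: "V_sup S J T p \<tau> x < \<infinity>"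
  using V_sup_le[of \<tau> x] by (simp add: order_le_less_trans)

lemma ennreal_V: "ennreal (V \<tau> x) = V_sup S J T p \<tau> x"
  using V_sup_finite by simp

lemma V_le: "V \<tau> x \<le> cost_const * norm x powr p"
  using V_sup_le[of \<tau> x] cost_const_pos by (intro enn2real_leI) auto

lemma V_lipschitz_le:
  assumes "norm x \<le> r"
  shows "V \<tau> x \<le> V \<tau> y + cost_const * r powr (p - 1) * norm (x - y)"
proof -
  have "ennreal (V \<tau> x) \<le> ennreal (V \<tau> y) + ennreal (cost_const * r powr (p - 1) * norm (x - y))"
    using V_sup_lipschitz[OF assms] by (simp only: ennreal_V)
  then show ?thesis
    using cost_const_pos by (simp add: ennreal_plus[symmetric] del: ennreal_plus)
qed

lemma V_lipschitz:
  assumes "norm x \<le> r" "norm y \<le> r"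
  shows "\<bar>V \<tau> x - V \<tau> y\<bar> \<le> cost_const * r powr (p - 1) * norm (x - y)"
  using V_lipschitz_le[OF assms(1), of \<tau> y] V_lipschitz_le[OF assms(2), of \<tau> x]
  by (simp add: norm_minus_commute)

lemma V_mono: "\<tau> \<le> \<tau>' \<Longrightarrow> V \<tau> x \<le> V \<tau>' x"
  using V_sup_finite unfolding V_sup_def
  by (intro enn2real_mono SUP_subset_mono S_clock_mono) auto

text \<open>
  The integral over the free flow is replaced by a lower bound \<open>m\<close> of its integrand: \<open>m = 0\<close> serves for
  continuity in the clock, \<open>m\<close> close to \<open>\<parallel>x\<parallel>\<^sup>p\<close> for the Dini derivative.
\<close>
lemma V_delay:
  assumes "0 \<le> h" "0 \<le> \<tau>" "0 \<le> m" "\<And>t. 0 \<le> t \<Longrightarrow> t < h \<Longrightarrow> m \<le> norm (S t x) powr p"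
  shows "h * m + V (\<tau> + h) (S h x) \<le> V \<tau> x"
proof -
  have "S_clock T (\<tau> + h) \<noteq> {}"
    using exists_S_min[OF T] S_clock_mono[of 0 "\<tau> + h" T] assms S_min_eq_S_clock_0[OF T] by fastforce
  then have "ennreal (h * m) + V_sup S J T p (\<tau> + h) (S h x)
      = (SUP \<sigma>\<in>S_clock T (\<tau> + h). ennreal (h * m) + trajectory_cost S J p \<sigma> 0 (S h x))"
    unfolding V_sup_def by (rule ennreal_SUP_add_right)
  also have "\<dots> \<le> V_sup S J T p \<tau> x"
  proof (rule SUP_least)
    fix \<sigma> assume \<sigma>: "\<sigma> \<in> S_clock T (\<tau> + h)"
    have "ennreal (h * m) = (\<integral>\<^sup>+t\<in>{0..<h}. ennreal m \<partial>lborel)"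
      using assms by (simp add: nn_integral_cmult_indicator ennreal_mult mult.commute)
    also have "\<dots> \<le> (\<integral>\<^sup>+t\<in>{0..<h}. ennreal (norm (S t x) powr p) \<partial>lborel)"
      using assms(4) by (intro nn_integral_mono) (auto simp: indicator_def intro: ennreal_leI)
    finally have "ennreal (h * m) + trajectory_cost S J p \<sigma> 0 (S h x)
        \<le> trajectory_cost S J p (delay h \<sigma>) 0 x"
      using trajectory_cost_delay[of \<sigma> p h x] \<sigma> p assms(1) S_clock_impulse_seqs[OF \<sigma>]
      by (auto intro: add_right_mono)
    also have "\<dots> \<le> V_sup S J T p \<tau> x"
      unfolding V_sup_def using delay_in_S_clock[OF \<sigma> assms(1)] by (rule SUP_upper)
    finally show "ennreal (h * m) + trajectory_cost S J p \<sigma> 0 (S h x) \<le> V_sup S J T p \<tau> x" .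
  qed
  finally have "ennreal (h * m) + ennreal (V (\<tau> + h) (S h x)) \<le> ennreal (V \<tau> x)"
    by (simp only: ennreal_V)
  then show ?thesis
    using assms by (simp add: ennreal_plus[symmetric] del: ennreal_plus)
qed

lemma V_jump_delayed:
  assumes "0 < \<theta>"
  shows "norm (S \<theta> x) powr p + V 0 (J (S \<theta> x)) \<le> V T x"
proof -
  have "ennreal (norm (S \<theta> x) powr p) + ennreal (V 0 (J (S \<theta> x))) \<le> ennreal (V T x)"
    unfolding ennreal_V using prepend_in_S_clock assms p T by (intro V_sup_prepend) auto
  then show ?thesis
    by (simp add: ennreal_plus[symmetric] del: ennreal_plus)
qed

lemma isCont_V: "isCont (V \<tau>) x"
proof -
  have "continuous_on (ball 0 (norm x + 1)) (V \<tau>)"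
  proof (rule lipschitz_on_continuous_on)
    show "(cost_const * (norm x + 1) powr (p - 1))-lipschitz_on (ball 0 (norm x + 1)) (V \<tau>)"
      using cost_const_pos V_lipschitz[of _ "norm x + 1"]
      by (intro lipschitz_onI) (auto simp: dist_norm)
  qed
  then show ?thesis by (rule continuous_on_interior) simp
qed

text \<open>
  In \<open>V_jump_delayed\<close> the time of the impulse tends to \<open>0\<close>.
\<close>
lemma V_jump: "V 0 (J x) - V T x \<le> - (norm x powr p)"
proof -
  have "((\<lambda>\<theta>. norm (S \<theta> x) powr p + V 0 (J (S \<theta> x))) \<longlongrightarrow> norm x powr p + V 0 (J x)) (at_right 0)"
    using S_tendsto_0[of x] p
    by (intro tendsto_add tendsto_powr2 tendsto_norm tendsto_const isCont_tendsto_compose[OF isCont_V]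
        blinfun.tendsto tendsto_const) auto
  moreover have "eventually (\<lambda>\<theta>. norm (S \<theta> x) powr p + V 0 (J (S \<theta> x)) \<le> V T x) (at_right 0)"
    using V_jump_delayed eventually_at_right_less[of "0::real"] by (auto elim: eventually_mono)
  ultimately have "norm x powr p + V 0 (J x) \<le> V T x"
    by (intro tendsto_upperbound) auto
  then show ?thesis by simp
qed

text \<open>
  For clock values \<open>a \<le> b\<close> the classes increase, so \<open>V a x \<le> V b x\<close>. Conversely \<open>V b (S (b - a) x) \<le> V a x\<close>,
  because the clock reaches \<open>b\<close> after free flow of duration \<open>b - a\<close>, and replacing \<open>S (b - a) x\<close> by \<open>x\<close> costs
  one Lipschitz term.
\<close>
lemma V_clock_increment:
  assumes "0 \<le> \<tau>" "0 \<le> \<tau>'"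
  shows "\<bar>V \<tau>' x - V \<tau> x\<bar> \<le> cost_const * (G * norm x) powr (p - 1) * norm (S \<bar>\<tau>' - \<tau>\<bar> x - x)"
proof -
  have *: "\<bar>V b x - V a x\<bar> \<le> cost_const * (G * norm x) powr (p - 1) * norm (S (b - a) x - x)"
    if "0 \<le> a" "a \<le> b" for a b
  proof -
    have "norm x \<le> G * norm x" using G_ge_1 mult_right_mono[of 1 G "norm x"] by simp
    then have "V b x \<le> V b (S (b - a) x) + cost_const * (G * norm x) powr (p - 1) * norm (S (b - a) x - x)"
      using V_lipschitz_le[of x "G * norm x" b "S (b - a) x"] by (simp add: norm_minus_commute)
    moreover have "V b (S (b - a) x) \<le> V a x"
      using V_delay[of "b - a" a 0 x] that by simp
    moreover have "V a x \<le> V b x" using that by (intro V_mono)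
    ultimately show ?thesis by simp
  qed
  show ?thesis
    using *[of \<tau> \<tau>'] *[of \<tau>' \<tau>] assms by (cases "\<tau> \<le> \<tau>'") (auto simp: abs_minus_commute)
qed

lemma continuous_on_V_clock: "continuous_on {0..} (\<lambda>\<tau>. V \<tau> x)"
  unfolding continuous_on_iff
proof (intro ballI allI impI)
  fix \<tau> e :: real assume "\<tau> \<in> {0..}" "0 < e"
  define L where "L = cost_const * (G * norm x) powr (p - 1)"
  have L: "0 \<le> L" using cost_const_pos by (simp add: L_def)
  then have "0 < e / (L + 1)" using \<open>0 < e\<close> by simp
  then obtain d where "0 < d" and d: "\<And>h. 0 \<le> h \<Longrightarrow> h < d \<Longrightarrow> norm (S h x - x) < e / (L + 1)"
    using S_near_0 by blast
  have "dist (V \<tau>' x) (V \<tau> x) < e" if "\<tau>' \<in> {0..}" "dist \<tau>' \<tau> < d" for \<tau>'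
  proof -
    have "\<bar>V \<tau>' x - V \<tau> x\<bar> \<le> L * norm (S \<bar>\<tau>' - \<tau>\<bar> x - x)"
      using V_clock_increment[of \<tau> \<tau>' x] that \<open>\<tau> \<in> {0..}\<close> by (simp add: L_def)
    also have "\<dots> \<le> L * (e / (L + 1))"
      using d[of "\<bar>\<tau>' - \<tau>\<bar>"] that L by (intro mult_left_mono) (auto simp: dist_real_def)
    also have "\<dots> < e" using L \<open>0 < e\<close> by (simp add: field_simps)
    finally show ?thesis by (simp add: dist_real_def)
  qed
  then show "\<exists>d>0. \<forall>\<tau>'\<in>{0..}. dist \<tau>' \<tau> < d \<longrightarrow> dist (V \<tau>' x) (V \<tau> x) < e"
    using \<open>0 < d\<close> by blast
qed

text \<open>
  The average of \<open>\<parallel>S t x\<parallel>\<^sup>p\<close> over \<open>[0, h]\<close> tends to \<open>\<parallel>x\<parallel>\<^sup>p\<close>; the estimate holds even for the upper Dini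
  derivative.
\<close>
lemma lower_Dini_V:
  assumes "0 \<le> \<tau>"
  shows "lower_Dini S V \<tau> x \<le> ereal (- (norm x powr p))"
proof -
  let ?q = "\<lambda>h. (V (\<tau> + h) (S h x) - V \<tau> x) / h"
  have "lower_Dini S V \<tau> x \<le> ereal (- (norm x powr p) + e)" if "0 < e" for e
  proof -
    have "((\<lambda>t. norm (S t x) powr p) \<longlongrightarrow> norm x powr p) (at_right 0)"
      using S_tendsto_0[of x] p by (intro tendsto_powr2 tendsto_norm tendsto_const) auto
    then have "eventually (\<lambda>t. norm x powr p - e < norm (S t x) powr p) (at_right 0)"
      using that by (intro order_tendstoD) auto
    then obtain d where "0 < d" and d: "\<And>t. 0 < t \<Longrightarrow> t < d \<Longrightarrow> norm x powr p - e < norm (S t x) powr p"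
      by (auto simp: eventually_at_right_field)
    define m where "m = max 0 (norm x powr p - e)"
    have m: "m \<le> norm (S t x) powr p" if "0 \<le> t" "t < d" for t
      using d[of t] that \<open>0 < e\<close> by (cases "t = 0") (auto simp: m_def)
    have "?q h \<le> - (norm x powr p) + e" if "0 < h" "h < d" for h
    proof -
      have "h * m + V (\<tau> + h) (S h x) \<le> V \<tau> x"
        using m that assms by (intro V_delay) (auto simp: m_def)
      then have "?q h \<le> - m" using that by (simp add: field_simps)
      then show ?thesis by (simp add: m_def)
    qed
    then have "eventually (\<lambda>h. ereal (?q h) \<le> ereal (- (norm x powr p) + e)) (at_right 0)"
      using \<open>0 < d\<close> by (auto simp: eventually_at_right_field)
    then have "Limsup (at_right 0) (\<lambda>h. ereal (?q h)) \<le> ereal (- (norm x powr p) + e)"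
      by (rule Limsup_bounded)
    then show ?thesis
      unfolding lower_Dini_def
      using Liminf_le_Limsup[of "at_right (0::real)"] by (meson order_trans trivial_limit_at_right_real)
  qed
  note bound = this
  show ?thesis
    by (rule ereal_le_epsilon2) (use bound in simp)
qed

lemma clock_Lyapunov_V: "clock_Lyapunov S J T p cost_const V"
  unfolding clock_Lyapunov_def
proof (intro conjI allI impI ballI)
  fix r :: real assume "0 < r"
  define L where "L = cost_const * r powr (p - 1)"
  have "0 < L" using cost_const_pos \<open>0 < r\<close> by (simp add: L_def)
  moreover have "L-lipschitz_on (ball 0 r) (V \<tau>)" for \<tau>
    using V_lipschitz[of _ r _ \<tau>] \<open>0 < L\<close> by (intro lipschitz_onI) (simp_all add: dist_norm dist_real_def L_def)
  ultimately show "\<exists>L>0. \<forall>\<tau>\<in>{0..T}. L-lipschitz_on (ball 0 r) (V \<tau>)" by blast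
next
  fix x show "continuous_on {0..T} (\<lambda>\<tau>. V \<tau> x)"
    by (rule continuous_on_subset[OF continuous_on_V_clock]) auto
next
  fix \<tau> assume "T \<le> \<tau>"
  then have "S_clock T \<tau> = S_clock T T" by (simp add: S_clock_def)
  then show "V \<tau> = V T" by (simp add: V_sup_def)
qed (use V_le lower_Dini_V V_jump T in auto)

end
end

section \<open>Decrease of a Lyapunov functional along the semigroup\<close>

text \<open>
  Let \<open>e > 0\<close>. The set of times at which \<open>f\<close> lies on or below the line through \<open>(a, f a)\<close> with slope
  \<open>e - m\<close> is closed, and from every point of it other than \<open>b\<close> the Dini bound leads to a point of it
  further to the right. Hence its supremum is \<open>b\<close>.
\<close>
lemma lower_right_Dini_le_imp_le:
  fixes f :: "real \<Rightarrow> real"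
  assumes "a \<le> b" and cont: "continuous_on {a..b} f"
    and Dini: "\<And>t. a \<le> t \<Longrightarrow> t < b \<Longrightarrow>
      Liminf (at_right 0) (\<lambda>h. ereal ((f (t + h) - f t) / h)) \<le> ereal (- m)"
  shows "f b \<le> f a - m * (b - a)"
proof -
  have "f b \<le> f a + (e - m) * (b - a)" if "0 < e" for e
  proof -
    define A where "A = {t \<in> {a..b}. f t \<le> f a + (e - m) * (t - a)}"
    have "closed A"
      unfolding A_def by (intro continuous_on_closed_Collect_le cont continuous_intros closed_atLeastAtMost)
    moreover have A: "a \<in> A" "bdd_above A"
      using assms(1) by (auto simp: A_def intro: bdd_aboveI[of _ b])
    ultimately have c: "Sup A \<in> A" by (intro closed_contains_Sup) auto
    define c where "c = Sup A"
    have "c = b"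
    proof (rule ccontr)
      assume "c \<noteq> b"
      then have "a \<le> c" "c < b" using c by (auto simp: A_def c_def)
      then have "\<not> ereal (e - m) \<le> Liminf (at_right 0) (\<lambda>h. ereal ((f (c + h) - f c) / h))"
        using order_trans[OF _ Dini[of c], of "ereal (e - m)"] that by auto
      then have "\<not> eventually (\<lambda>h. ereal (e - m) \<le> ereal ((f (c + h) - f c) / h)) (at_right 0)"
        by (rule contrapos_nn) (rule Liminf_bounded)
      moreover have "0 < b - c" using \<open>c < b\<close> by simp
      ultimately obtain h where h: "0 < h" "h < b - c"
        and "\<not> ereal (e - m) \<le> ereal ((f (c + h) - f c) / h)"
        unfolding eventually_at_right_field by blast
      then have "(f (c + h) - f c) / h < e - m" by (simp add: not_le)
      then have "(f (c + h) - f c) < (e - m) * h" using h by (simp add: pos_divide_less_eq)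
      then have "f (c + h) \<le> f c + (e - m) * h" by simp
      moreover have "f c \<le> f a + (e - m) * (c - a)" using c by (simp add: A_def c_def)
      ultimately have "c + h \<in> A" using h \<open>a \<le> c\<close> by (auto simp: A_def algebra_simps)
      then have "c + h \<le> c" unfolding c_def by (rule cSup_upper) (rule A)
      then show False using h by simp
    qed
    then show ?thesis using c by (simp add: A_def c_def)
  qed
  note * = this
  have "f b \<le> (f a - m * (b - a)) + d" if "0 < d" for d
  proof -
    have "d / (b - a + 1) * (b - a) \<le> d"
      using that assms(1) by (simp add: field_simps)
    then show ?thesis
      using *[of "d / (b - a + 1)"] that assms(1) by (simp add: algebra_simps)
  qed
  then show ?thesis by (rule field_le_epsilon)
qed

text \<open>
  Two decay bounds, one uniform and one exponential in \<open>\<theta>\<close>, yield half of the first together with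
  exponential decay. The switch is at \<open>\<gamma> \<theta> = k + L\<close>, where the two bounds coincide; the rate is chosen so
  that up to this point it uses up the other half of the first bound.
\<close>
lemma exp_interpolation:
  fixes L k \<gamma> \<theta> :: real
  assumes "0 < \<gamma>" "0 < L" "0 \<le> k" "0 \<le> \<theta>"
  shows "min (exp (- L)) (exp (k - \<gamma> * \<theta>)) \<le> exp (- L / 2 - \<gamma> * L / (2 * (k + L)) * \<theta>)"
proof -
  define u where "u = L / (2 * (k + L))"
  have u: "0 \<le> u" "u \<le> 1" "u * (k + L) = L / 2"
    using assms by (auto simp: u_def field_simps)
  have exponent: "\<gamma> * L / (2 * (k + L)) * \<theta> = u * (\<gamma> * \<theta>)" by (simp add: u_def)
  show ?thesis
  proof (cases "\<gamma> * \<theta> \<le> k + L")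
    case True
    then have "u * (\<gamma> * \<theta>) \<le> u * (k + L)" using u by (intro mult_left_mono) auto
    then show ?thesis unfolding exponent u(3) by (intro min.coboundedI1) simp
  next
    case False
    then have "(1 - u) * (k + L) \<le> (1 - u) * (\<gamma> * \<theta>)"
      using u by (intro mult_left_mono) auto
    then have "k - \<gamma> * \<theta> \<le> - L / 2 - u * (\<gamma> * \<theta>)"
      using u(3) by (simp add: algebra_simps)
    then show ?thesis unfolding exponent by (intro min.coboundedI2) simp
  qed
qed

lemma powr_le_imp_le_powr_inverse:
  fixes a b p :: real
  assumes "0 \<le> a" "0 < p" "a powr p \<le> b"
  shows "a \<le> b powr (1 / p)"
proof -
  have "a = (a powr p) powr (1 / p)" using assms by (simp add: powr_powr)
  also have "\<dots> \<le> b powr (1 / p)" using assms by (intro powr_mono2) auto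
  finally show ?thesis .
qed

lemma clock_LyapunovD:
  assumes "clock_Lyapunov S J T p c W"
  shows clock_Lyapunov_nonneg: "\<tau> \<in> {0..T} \<Longrightarrow> 0 \<le> W \<tau> x"
    and clock_Lyapunov_lipschitz: "0 < r \<Longrightarrow> \<exists>L>0. \<forall>\<tau>\<in>{0..T}. L-lipschitz_on (ball 0 r) (W \<tau>)"
    and clock_Lyapunov_continuous: "continuous_on {0..T} (\<lambda>\<tau>. W \<tau> x)"
    and clock_Lyapunov_late: "T \<le> \<tau> \<Longrightarrow> W \<tau> = W T"
    and clock_Lyapunov_upper: "\<tau> \<in> {0..T} \<Longrightarrow> W \<tau> x \<le> c * norm x powr p"
    and clock_Lyapunov_Dini: "\<tau> \<in> {0..T} \<Longrightarrow> lower_Dini S W \<tau> x \<le> ereal (- (norm x powr p))"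
    and clock_Lyapunov_jump: "W 0 (J x) - W T x \<le> - (norm x powr p)"
  using assms unfolding clock_Lyapunov_def by blast+

context impulsive_flow
begin

lemma norm_S_le_earlier:
  assumes "0 \<le> s" "s \<le> t"
  shows "norm (S t x) \<le> G * norm (S s x)"
  using S_add[of "t - s" s] S_le[of "t - s" "S s x"] assms by simp

text \<open>
  Datko's argument for a bounded semigroup: taking \<open>m\<close> as large as the final value permits, the hypothesis
  bounds \<open>t \<parallel>S t x\<parallel>\<^sup>p\<close>, so \<open>\<parallel>S d\<parallel> \<le> 1/2\<close> for some \<open>d\<close>, and the semigroup law turns this into
  exponential decay.
\<close>
lemma exponentially_stable_if_orbit_bound:
  assumes "0 < p" and orbit: "\<And>t x m. 0 \<le> t \<Longrightarrow> 0 \<le> m \<Longrightarrow>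
      (\<And>s. 0 \<le> s \<Longrightarrow> s \<le> t \<Longrightarrow> m \<le> norm (S s x) powr p) \<Longrightarrow> m * t \<le> c * norm x powr p"
  shows "exponentially_stable S"
proof -
  define K where "K = G powr p * c"
  have bound: "t * norm (S t x) powr p \<le> K * norm x powr p" if "0 \<le> t" for t x
  proof -
    \<comment> \<open>The orbit can grow by at most the factor \<open>G\<close>, so it was at least this large before \<open>t\<close>.\<close>
    define m where "m = (norm (S t x) / G) powr p"
    have "m \<le> norm (S s x) powr p" if "0 \<le> s" "s \<le> t" for s
      unfolding m_def using norm_S_le_earlier[OF that, of x] G_ge_1 assms(1)
      by (intro powr_mono2) (auto simp: field_simps)
    then have "m * t \<le> c * norm x powr p"
      using that by (intro orbit) (auto simp: m_def)
    then have "G powr p * (m * t) \<le> G powr p * (c * norm x powr p)" by (rule mult_left_mono) simp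
    moreover have "G powr p * (m * t) = t * norm (S t x) powr p"
      using G_ge_1 by (simp add: m_def powr_divide)
    ultimately show ?thesis by (simp add: K_def mult.assoc)
  qed
  define d where "d = \<bar>K\<bar> * 2 powr p + 1"
  have d: "0 < d" by (simp add: d_def add_nonneg_pos)
  have "norm (S d x) \<le> norm x / 2" for x
  proof (rule ccontr)
    assume "\<not> norm (S d x) \<le> norm x / 2"
    then have "(norm x / 2) powr p < norm (S d x) powr p"
      using assms(1) by (intro powr_less_mono2) auto
    then have "d * (norm x / 2) powr p < d * norm (S d x) powr p"
      using d by simp
    also have "\<dots> \<le> K * norm x powr p" using bound d by simp
    also have "\<dots> \<le> (\<bar>K\<bar> * 2 powr p) * (norm x / 2) powr p"
      by (simp add: powr_divide mult_right_mono)
    also have "\<dots> \<le> d * (norm x / 2) powr p"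
      by (intro mult_right_mono) (auto simp: d_def)
    finally show False by simp
  qed
  then have half: "norm (S d) \<le> 1 / 2" by (intro norm_blinfun_bound) auto
  have powers: "norm (S (real n * d)) \<le> (1 / 2) ^ n" for n
  proof (induction n)
    case 0
    then show ?case using norm_blinfun_id_le by simp
  next
    case (Suc n)
    have "S (real (Suc n) * d) = S d o\<^sub>L S (real n * d)"
      using S_add[of d "real n * d"] d by (simp add: algebra_simps)
    then have "norm (S (real (Suc n) * d)) \<le> norm (S d) * norm (S (real n * d))"
      by (simp add: norm_blinfun_compose)
    also have "\<dots> \<le> 1 / 2 * (1 / 2) ^ n" using half Suc by (intro mult_mono) auto
    finally show ?case by simp
  qed
  have "norm (S t) \<le> 2 * G * exp (- (ln 2 / d) * t)" if "0 \<le> t" for t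
  proof -
    define n where "n = nat \<lfloor>t / d\<rfloor>"
    have n: "real n * d \<le> t" "t / d - 1 \<le> real n"
      using that d by (auto simp: n_def pos_le_divide_eq[symmetric])
    have "S t = S (t - real n * d) o\<^sub>L S (real n * d)"
      using S_add[of "t - real n * d" "real n * d"] n d by simp
    then have "norm (S t) \<le> norm (S (t - real n * d)) * norm (S (real n * d))"
      by (simp add: norm_blinfun_compose)
    also have "\<dots> \<le> G * (1 / 2) ^ n"
      using n powers[of n] S_bound[of "t - real n * d"] G_ge_1 by (intro mult_mono) auto
    also have "(1 / 2 :: real) ^ n = exp (- ln 2 * real n)"
      by (simp add: exp_minus exp_of_nat2_mult power_divide inverse_eq_divide)
    also have "\<dots> \<le> exp (ln 2 + - (ln 2 / d) * t)"
    proof -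
      have "ln 2 * (t / d - 1) \<le> ln 2 * real n" using n by (intro mult_left_mono) auto
      then show ?thesis by (simp add: algebra_simps)
    qed
    finally show ?thesis using G_ge_1 by (simp add: exp_diff exp_minus divide_inverse ac_simps)
  qed
  moreover have "1 \<le> 2 * G" "0 < ln 2 / d" using G_ge_1 d by auto
  ultimately show ?thesis unfolding exponentially_stable_def by blast
qed

text \<open>
  Along \<open>s \<mapsto> W (\<tau> + s) (S s x)\<close> the lower Dini derivative is the one in the definition of a clock functional,
  taken at the clock value \<open>\<tau> + s\<close>, or at \<open>T\<close> once the clock has run out. It remains to see that this
  function is continuous, for which the Lipschitz bound has to be uniform in the clock.
\<close>
lemma clock_Lyapunov_flow:
  assumes Lyap: "clock_Lyapunov S J T p c W" and "0 < T"
    and "0 \<le> \<tau>" "0 \<le> t" and m: "\<And>s. 0 \<le> s \<Longrightarrow> s \<le> t \<Longrightarrow> m \<le> norm (S s x) powr p"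
  shows "W (\<tau> + t) (S t x) \<le> W \<tau> x - m * t"
proof -
  have W_late: "W r = W T" if "T \<le> r" for r
    by (rule clock_Lyapunov_late[OF Lyap that])
  have W_min: "W r = W (min r T)" for r
    using W_late[of r] by (cases "r \<le> T") simp_all
  let ?f = "\<lambda>s. W (\<tau> + s) (S s x)"
  obtain L where "0 < L" and L: "\<And>r. r \<in> {0..T} \<Longrightarrow> L-lipschitz_on (ball 0 (G * norm x + 1)) (W r)"
  proof -
    have "0 < G * norm x + 1" using G_ge_1 by (simp add: add_nonneg_pos)
    then show thesis using clock_Lyapunov_lipschitz[OF Lyap] that by meson
  qed
  have "continuous_on {0..t} ?f"
    unfolding continuous_on_def
  proof
    fix s assume s: "s \<in> {0..t}"
    have clock: "((\<lambda>u. W (\<tau> + u) (S s x)) \<longlongrightarrow> W (\<tau> + s) (S s x)) (at s within {0..t})"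
    proof -
      have "continuous_on {0..T} (\<lambda>r. W r (S s x))"
        by (rule clock_Lyapunov_continuous[OF Lyap])
      then have "continuous_on {0..t} (\<lambda>u. W (min (\<tau> + u) T) (S s x))"
        by (rule continuous_on_compose2) (use assms in \<open>auto intro!: continuous_intros\<close>)
      moreover have "W (min (\<tau> + u) T) (S s x) = W (\<tau> + u) (S s x)" for u
        by (simp only: W_min[of "\<tau> + u", symmetric])
      ultimately show ?thesis using s by (simp add: continuous_on_def)
    qed
    have "((\<lambda>u. S u x) \<longlongrightarrow> S s x) (at s within {0..t})"
      using continuous_on_subset[OF continuous_on_S, of "{0..t}" x] s by (auto simp: continuous_on_def)
    then have "((\<lambda>u. dist (S u x) (S s x)) \<longlongrightarrow> 0) (at s within {0..t})"
      by (simp only: tendsto_dist_iff[symmetric])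
    then have state: "((\<lambda>u. L * dist (S u x) (S s x)) \<longlongrightarrow> 0) (at s within {0..t})"
      by (rule tendsto_mult_right_zero)
    have "eventually (\<lambda>u. norm (W (\<tau> + u) (S u x) - W (\<tau> + u) (S s x)) \<le> L * dist (S u x) (S s x))
        (at s within {0..t})"
      unfolding eventually_at_filter
    proof (intro always_eventually allI impI)
      fix u assume "u \<in> {0..t}"
      then have "S u x \<in> ball 0 (G * norm x + 1)" "S s x \<in> ball 0 (G * norm x + 1)"
        using S_le[of u x] S_le[of s x] s by auto
      then show "norm (W (\<tau> + u) (S u x) - W (\<tau> + u) (S s x)) \<le> L * dist (S u x) (S s x)"
        using lipschitz_onD[OF L[of "min (\<tau> + u) T"], of "S u x" "S s x"] \<open>u \<in> {0..t}\<close> assms(2,3)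
        by (simp add: W_min[of "\<tau> + u", symmetric] dist_real_def)
    qed
    then have "((\<lambda>u. W (\<tau> + u) (S u x) - W (\<tau> + u) (S s x)) \<longlongrightarrow> 0) (at s within {0..t})"
      using state by (rule Lim_null_comparison)
    from tendsto_add[OF this clock] show "(?f \<longlongrightarrow> ?f s) (at s within {0..t})" by simp
  qed
  moreover have "Liminf (at_right 0) (\<lambda>h. ereal ((?f (s + h) - ?f s) / h)) \<le> ereal (- m)"
    if s: "0 \<le> s" "s < t" for s
  proof -
    have "Liminf (at_right 0) (\<lambda>h. ereal ((?f (s + h) - ?f s) / h))
        = Liminf (at_right 0) (\<lambda>h. ereal ((W (min (\<tau> + s) T + h) (S h (S s x)) - W (min (\<tau> + s) T) (S s x)) / h))"
    proof (rule Liminf_eq)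
      show "eventually (\<lambda>h. ereal ((?f (s + h) - ?f s) / h)
          = ereal ((W (min (\<tau> + s) T + h) (S h (S s x)) - W (min (\<tau> + s) T) (S s x)) / h)) (at_right 0)"
        using eventually_at_right_less[of "0::real"]
      proof eventually_elim
        fix h :: real assume "0 < h"
        then have "S (s + h) x = S h (S s x)" using S_add[of h s] s by (simp add: add.commute)
        moreover have "W (\<tau> + (s + h)) = W (min (\<tau> + s) T + h)"
          using W_late[of "\<tau> + (s + h)"] W_late[of "T + h"] \<open>0 < h\<close>
          by (cases "\<tau> + s \<le> T") (simp_all add: add.assoc)
        ultimately show "ereal ((?f (s + h) - ?f s) / h)
          = ereal ((W (min (\<tau> + s) T + h) (S h (S s x)) - W (min (\<tau> + s) T) (S s x)) / h)"
          by (simp only: W_min[of "\<tau> + s", symmetric])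
      qed
    qed
    also have "\<dots> \<le> ereal (- (norm (S s x) powr p))"
      using clock_Lyapunov_Dini[OF Lyap, of "min (\<tau> + s) T" "S s x"] s assms(2,3)
      by (simp add: lower_Dini_def)
    also have "\<dots> \<le> ereal (- m)" using m[of s] s by simp
    finally show ?thesis .
  qed
  ultimately have "?f t \<le> ?f 0 - m * (t - 0)"
    using assms by (intro lower_right_Dini_le_imp_le) auto
  then show ?thesis by simp
qed

text \<open>
  Between impulses the functional can be used with the clock kept at \<open>T\<close> for an unlimited time.
\<close>
lemma clock_Lyapunov_exponentially_stable:
  assumes Lyap: "clock_Lyapunov S J T p c W" and "0 < T" "1 \<le> p"
  shows "exponentially_stable S"
proof (rule exponentially_stable_if_orbit_bound)
  fix t m :: real and x
  assume "0 \<le> t" and m: "\<And>s. 0 \<le> s \<Longrightarrow> s \<le> t \<Longrightarrow> m \<le> norm (S s x) powr p"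
  then have "W (T + t) (S t x) \<le> W T x - m * t"
    using assms by (intro clock_Lyapunov_flow[OF Lyap]) auto
  moreover have "W (T + t) = W T" "0 \<le> W T (S t x)" "W T x \<le> c * norm x powr p"
    using clock_Lyapunov_late[OF Lyap, of "T + t"] clock_Lyapunov_nonneg[OF Lyap, of T "S t x"]
      clock_Lyapunov_upper[OF Lyap, of T x] \<open>0 \<le> t\<close> \<open>0 < T\<close> by simp_all
  ultimately show "m * t \<le> c * norm x powr p" by simp
qed (use assms in simp)

lemma clock_Lyapunov_impulse_to_impulse:
  assumes Lyap: "clock_Lyapunov S J T p c W" and "0 < T" "T \<le> \<theta>"
  shows "W T (S \<theta> (J x)) - W T x \<le> - (norm x powr p)"
proof -
  have "W (0 + \<theta>) (S \<theta> (J x)) \<le> W 0 (J x) - 0 * \<theta>"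
    using assms by (intro clock_Lyapunov_flow[OF Lyap]) auto
  moreover have "W \<theta> = W T" "W 0 (J x) - W T x \<le> - (norm x powr p)"
    using clock_Lyapunov_late[OF Lyap, of \<theta>] clock_Lyapunov_jump[OF Lyap, of x] assms by simp_all
  ultimately show ?thesis by simp
qed

end

section \<open>Decrease from impulse to impulse\<close>

context impulsive_flow
begin

text \<open>
  In this form the dwell time condition is available for induction on the list of impulses.
\<close>
lemma sorted_wrt_impulse_gaps:
  assumes "\<sigma> \<in> S_min T" "0 < T"
  shows "sorted_wrt (\<lambda>a b. a + T \<le> b) (sorted_list_of_set (impulse_times \<sigma> \<inter> {s<..t}))"
proof -
  have \<sigma>: "\<sigma> \<in> impulse_seqs" "\<And>k. T \<le> \<sigma> (k + 1) - \<sigma> k"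
    using assms by (auto simp: S_min_def)
  have gap: "a + T \<le> b"
    if ab: "a \<in> impulse_times \<sigma>" "b \<in> impulse_times \<sigma>" "a < b" for a b
  proof -
    obtain i j where ij: "a = \<sigma> i" "b = \<sigma> j" using ab(1,2) by (auto simp: impulse_times_def)
    have "i < j" using ab(3) ij strict_mono_less[OF impulse_seqs_strict_mono[OF \<sigma>(1)]] by simp
    then have "\<sigma> (i + 1) \<le> \<sigma> j"
      using strict_mono_less_eq[OF impulse_seqs_strict_mono[OF \<sigma>(1)], of "i + 1" j] by simp
    then show ?thesis using \<sigma>(2)[of i] ij by simp
  qed
  have fin: "finite (impulse_times \<sigma> \<inter> {s<..t})"
    by (rule finite_impulse_times_upto[OF \<sigma>(1), of _ t]) auto
  show ?thesis
    by (rule sorted_wrt_mono_rel[of _ "(<)"]) (use fin gap in auto)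
qed

text \<open>
  The hypothesis on \<open>W\<close> involves states immediately before impulses only. It makes \<open>W\<close> comparable to
  \<open>\<parallel>\<cdot>\<parallel>\<^sup>p\<close> and contracting in each step, by \<open>1 - 1/c\<close> and, because \<open>S\<close> is stable, by a multiple of
  \<open>exp (- \<gamma> \<theta>)\<close>; \<open>exp_interpolation\<close> combines the two. The free flow before the first impulse and after
  the last one is estimated by the stability of \<open>S\<close>.
\<close>
lemma strongly_UGES_if_impulse_to_impulse_decrease:
  fixes W :: "'a \<Rightarrow> real"
  assumes stable: "exponentially_stable S" and T: "0 < T" and p: "1 \<le> p"
    and W_nonneg: "\<And>x. 0 \<le> W x" and W_le: "\<And>x. W x \<le> c * norm x powr p"
    and decrease: "\<And>x \<theta>. T \<le> \<theta> \<Longrightarrow> norm x powr p + W (S \<theta> (J x)) \<le> W x"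
  shows "strongly_UGES S J (S_min T)"
proof -
  obtain M \<omega> where M: "1 \<le> M" and \<omega>: "0 < \<omega>"
    and "\<And>t. 0 \<le> t \<Longrightarrow> norm (S t) \<le> M * exp (- \<omega> * t)"
    using stable unfolding exponentially_stable_def by blast
  then have S_decay: "norm (S t x) \<le> M * exp (- \<omega> * t) * norm x" if "0 \<le> t" for t x
    using that norm_blinfun[of "S t" x] by (meson mult_right_mono norm_ge_zero order_trans)
  define \<gamma> where "\<gamma> = p * \<omega>"
  have \<gamma>: "0 < \<gamma>" using p \<omega> by (simp add: \<gamma>_def)
  have S_decay_p: "norm (S t x) powr p \<le> M powr p * exp (- \<gamma> * t) * norm x powr p" if "0 \<le> t" for t x
  proof -
    have "norm (S t x) powr p \<le> (M * exp (- \<omega> * t) * norm x) powr p"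
      using S_decay[OF that, of x] p by (intro powr_mono2) auto
    also have "\<dots> = M powr p * exp (- \<gamma> * t) * norm x powr p"
      using M by (simp add: powr_mult exp_powr_real \<gamma>_def ac_simps)
    finally show ?thesis .
  qed
  \<comment> \<open>Enlarged so that the contraction factor \<open>1 - 1/C\<close> is positive and has a logarithm.\<close>
  define C where "C = max 2 c"
  have C: "2 \<le> C" "c \<le> C" by (auto simp: C_def)
  have W_le_C: "W x \<le> C * norm x powr p" for x
    using W_le[of x] C(2) by (meson mult_right_mono order_trans powr_ge_zero)
  have W_ge: "norm x powr p \<le> W x" for x
    using decrease[of T x] W_nonneg[of "S T (J x)"] by simp
  \<comment> \<open>The summand \<open>1\<close> ensures \<open>1 \<le> B\<close>, and hence that \<open>k\<close> below is nonnegative.\<close>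
  define B where "B = (M * (norm J + 1)) powr p"
  have "1 * 1 \<le> M * (norm J + 1)" using M by (intro mult_mono) auto
  then have B: "1 \<le> B" using p by (simp add: B_def ge_one_powr_ge_zero)
  have SJ: "norm (S t (J x)) powr p \<le> B * exp (- \<gamma> * t) * norm x powr p" if "0 \<le> t" for t x
  proof -
    have "norm (J x) \<le> (norm J + 1) * norm x"
      using norm_blinfun[of J x] norm_ge_zero[of x] unfolding distrib_right by linarith
    then have "norm (J x) powr p \<le> ((norm J + 1) * norm x) powr p"
      using p by (intro powr_mono2) auto
    then have "M powr p * exp (- \<gamma> * t) * norm (J x) powr p
        \<le> M powr p * exp (- \<gamma> * t) * ((norm J + 1) * norm x) powr p"
      by (intro mult_left_mono) auto
    also have "\<dots> = B * exp (- \<gamma> * t) * norm x powr p"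
      using M by (simp add: B_def powr_mult ac_simps)
    finally show ?thesis using S_decay_p[OF that, of "J x"] by linarith
  qed
  define L where "L = - ln (1 - 1 / C)"
  define k where "k = ln (C * B)"
  have "0 < 1 - 1 / C" "1 - 1 / C < 1" using C(1) by auto
  then have L: "0 < L" "exp (- L) = 1 - 1 / C" by (auto simp: L_def)
  have "1 * 1 \<le> C * B" using B C(1) by (intro mult_mono) auto
  then have k: "0 \<le> k" "exp k = C * B" by (auto simp: k_def)
  define \<beta> where "\<beta> = \<gamma> * L / (2 * (k + L))"
  define q where "q = exp (- L / 2)"
  have q: "0 < q" "q < 1" using L by (auto simp: q_def)
  have \<beta>: "0 < \<beta>" "\<beta> \<le> \<gamma>" using \<gamma> L k by (auto simp: \<beta>_def field_simps)
  have W_step: "W (S \<theta> (J x)) \<le> q * exp (- \<beta> * \<theta>) * W x" if "T \<le> \<theta>" for \<theta> x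
  proof -
    have \<theta>: "0 \<le> \<theta>" using that T by simp
    have "W x / C \<le> norm x powr p" using W_le_C[of x] C(1) by (simp add: field_simps)
    then have "W (S \<theta> (J x)) \<le> exp (- L) * W x"
      using decrease[OF that, of x] by (simp add: L(2) algebra_simps)
    moreover have "W (S \<theta> (J x)) \<le> exp (k - \<gamma> * \<theta>) * W x"
    proof -
      have "W (S \<theta> (J x)) \<le> C * (B * exp (- \<gamma> * \<theta>) * norm x powr p)"
        using W_le_C[of "S \<theta> (J x)"] mult_left_mono[OF SJ[OF \<theta>, of x], of C] C(1) by linarith
      also have "\<dots> = exp (k - \<gamma> * \<theta>) * norm x powr p"
        using exp_add[of k "- \<gamma> * \<theta>"] k(2) by simp
      also have "\<dots> \<le> exp (k - \<gamma> * \<theta>) * W x" using W_ge by simp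
      finally show ?thesis .
    qed
    ultimately have "W (S \<theta> (J x)) \<le> min (exp (- L)) (exp (k - \<gamma> * \<theta>)) * W x"
      by (simp add: min_def)
    also have "\<dots> \<le> exp (- L / 2 - \<beta> * \<theta>) * W x"
      unfolding \<beta>_def using \<gamma> L k \<theta> W_nonneg by (intro mult_right_mono exp_interpolation) auto
    also have "exp (- L / 2 - \<beta> * \<theta>) = q * exp (- \<beta> * \<theta>)"
      unfolding q_def exp_add[symmetric] by simp
    finally show ?thesis .
  qed
  have after_impulse: "norm (propagate S J t a R (J y)) powr p
      \<le> B * q ^ length R * exp (- \<beta> * (t - a)) * W y"
    if "sorted_wrt (\<lambda>a b. a + T \<le> b) (a # R)" "\<And>b. b \<in> set (a # R) \<Longrightarrow> b \<le> t" for t a R y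
    using that
  proof (induction R arbitrary: a y)
    case Nil
    then have "a \<le> t" by simp
    have "norm (S (t - a) (J y)) powr p \<le> B * exp (- \<gamma> * (t - a)) * norm y powr p"
      using SJ[of "t - a" y] \<open>a \<le> t\<close> by simp
    also have "\<dots> \<le> B * exp (- \<beta> * (t - a)) * W y"
      using B \<beta> W_ge[of y] \<open>a \<le> t\<close>
      by (intro mult_mono mult_left_mono) (auto intro: mult_right_mono)
    finally show ?case by simp
  next
    case (Cons b R)
    have ab: "a + T \<le> b" using Cons.prems(1) by simp
    have "norm (propagate S J t b R (J (S (b - a) (J y)))) powr p
        \<le> B * q ^ length R * exp (- \<beta> * (t - b)) * W (S (b - a) (J y))"
      using Cons.prems by (intro Cons.IH) auto
    also have "\<dots> \<le> B * q ^ length R * exp (- \<beta> * (t - b)) * (q * exp (- \<beta> * (b - a)) * W y)"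
      using W_step[of "b - a" y] ab B q by (intro mult_left_mono) auto
    also have "\<dots> = B * q ^ length (b # R) * (exp (- \<beta> * (t - b)) * exp (- \<beta> * (b - a))) * W y"
      by simp
    also have "exp (- \<beta> * (t - b)) * exp (- \<beta> * (b - a)) = exp (- \<beta> * (t - a))"
      by (simp add: exp_add[symmetric] algebra_simps)
    finally show ?case by simp
  qed
  \<comment> \<open>With \<open>n\<close> impulses there are only \<open>n - 1\<close> steps between impulses, hence the division by \<open>q\<close>.\<close>
  define N where "N = B * C * M powr p / q"
  have Mp: "1 \<le> M powr p" using M p by (simp add: ge_one_powr_ge_zero)
  have "1 * 1 * 1 \<le> B * C * M powr p" using B C Mp by (intro mult_mono) auto
  then have N: "M powr p \<le> N" "1 \<le> N"
  proof -
    have "1 * M powr p \<le> B * C * M powr p" using B C mult_mono[of 1 B 1 C] by (intro mult_right_mono) auto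
    moreover have "B * C * M powr p \<le> N"
      unfolding N_def using q \<open>1 * 1 * 1 \<le> B * C * M powr p\<close> by (simp add: pos_le_divide_eq mult_left_le)
    ultimately show "M powr p \<le> N" by simp
    then show "1 \<le> N" using Mp by simp
  qed
  have U_bound_p: "norm (U S J \<sigma> t s x) powr p
      \<le> N * q ^ \<kappa> \<sigma> t s * exp (- \<beta> * (t - s)) * norm x powr p"
    if \<sigma>: "\<sigma> \<in> S_min T" and st: "0 \<le> s" "s \<le> t" for \<sigma> s t x
  proof -
    let ?A = "impulse_times \<sigma> \<inter> {s<..t}"
    have fin: "finite ?A"
      using \<sigma> by (intro finite_impulse_times_upto[of _ _ t] S_min_impulse_seqs) auto
    have len: "\<kappa> \<sigma> t s = length (sorted_list_of_set ?A)" by (simp add: \<kappa>_def)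
    show ?thesis
    proof (cases "sorted_list_of_set ?A")
      case Nil
      have "norm (U S J \<sigma> t s x) powr p \<le> M powr p * exp (- \<gamma> * (t - s)) * norm x powr p"
        using S_decay_p[of "t - s" x] st by (simp add: U_def Nil)
      also have "\<dots> \<le> N * exp (- \<beta> * (t - s)) * norm x powr p"
        using N \<beta> st by (intro mult_right_mono mult_mono) (auto intro: mult_right_mono)
      finally show ?thesis by (simp add: len Nil)
    next
      case (Cons a R)
      have "a \<in> ?A" "set (a # R) = ?A" using fin Cons by (metis list.set_intros(1) set_sorted_list_of_set)+
      then have a: "s \<le> a" "a \<le> t" by auto
      have "norm (U S J \<sigma> t s x) powr p
          \<le> B * q ^ length R * exp (- \<beta> * (t - a)) * W (S (a - s) x)"
        unfolding U_def Cons using sorted_wrt_impulse_gaps[OF \<sigma> T, of s t] \<open>set (a # R) = ?A\<close> Cons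
        by (simp only: propagate.simps blinfun_apply_blinfun_compose) (intro after_impulse, auto)
      also have "W (S (a - s) x) \<le> C * (M powr p * exp (- \<beta> * (a - s)) * norm x powr p)"
      proof -
        have "exp (- \<gamma> * (a - s)) \<le> exp (- \<beta> * (a - s))"
          using \<beta> a by (auto intro: mult_right_mono)
        then have "M powr p * exp (- \<gamma> * (a - s)) * norm x powr p
            \<le> M powr p * exp (- \<beta> * (a - s)) * norm x powr p"
          by (intro mult_right_mono mult_left_mono) auto
        then have "norm (S (a - s) x) powr p \<le> M powr p * exp (- \<beta> * (a - s)) * norm x powr p"
          using S_decay_p[of "a - s" x] a by simp
        then have "C * norm (S (a - s) x) powr p
            \<le> C * (M powr p * exp (- \<beta> * (a - s)) * norm x powr p)"
          using C by (intro mult_left_mono) auto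
        then show ?thesis using W_le_C[of "S (a - s) x"] by linarith
      qed
      also have "B * q ^ length R * exp (- \<beta> * (t - a)) * (C * (M powr p * exp (- \<beta> * (a - s)) * norm x powr p))
          = N * (q * q ^ length R) * (exp (- \<beta> * (t - a)) * exp (- \<beta> * (a - s))) * norm x powr p"
        using q by (simp add: N_def)
      also have "exp (- \<beta> * (t - a)) * exp (- \<beta> * (a - s)) = exp (- \<beta> * (t - s))"
        by (simp add: exp_add[symmetric] algebra_simps)
      finally show ?thesis
        using B q by (simp add: len Cons mult_left_mono)
    qed
  qed
  define M' \<rho> where "M' = N powr (1 / p)" and "\<rho> = q powr (1 / p)"
  have "norm (U S J \<sigma> t s) \<le> M' * \<rho> ^ \<kappa> \<sigma> t s * exp (- (\<beta> / p) * (t - s))"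
    if "\<sigma> \<in> S_min T" "0 \<le> s" "s \<le> t" for \<sigma> s t
  proof (rule norm_blinfun_bound)
    fix x
    have "norm (U S J \<sigma> t s x)
        \<le> (N * q ^ \<kappa> \<sigma> t s * exp (- \<beta> * (t - s)) * norm x powr p) powr (1 / p)"
      using p by (intro powr_le_imp_le_powr_inverse U_bound_p[OF that]) auto
    also have "\<dots> = M' * (q ^ \<kappa> \<sigma> t s) powr (1 / p) * exp (- \<beta> * (t - s)) powr (1 / p) * norm x"
      using N q p by (simp add: powr_mult powr_powr M'_def)
    also have "(q ^ \<kappa> \<sigma> t s) powr (1 / p) = \<rho> ^ \<kappa> \<sigma> t s"
      using q by (simp add: \<rho>_def powr_realpow[symmetric] powr_powr mult.commute)
    also have "exp (- \<beta> * (t - s)) powr (1 / p) = exp (- (\<beta> / p) * (t - s))"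
      by (simp add: exp_powr_real)
    finally show "norm (U S J \<sigma> t s x) \<le> M' * \<rho> ^ \<kappa> \<sigma> t s * exp (- (\<beta> / p) * (t - s)) * norm x" .
  qed (simp add: M'_def \<rho>_def)
  moreover have "1 \<le> M'" using N p by (simp add: M'_def ge_one_powr_ge_zero)
  moreover have "0 < \<rho>" "\<rho> < 1"
    using q p powr_less_mono2[of "1 / p" q 1] by (auto simp: \<rho>_def)
  moreover have "0 < \<beta> / p" using \<beta> p by simp
  ultimately show ?thesis unfolding strongly_UGES_def by blast
qed

context
  fixes T p b :: real
  assumes T: "0 < T" and p: "1 \<le> p"
    and cost: "\<And>\<sigma> x. \<sigma> \<in> S_min T \<Longrightarrow>
      trajectory_cost S J p \<sigma> 0 x \<le> ennreal (b powr p * norm x powr p)"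
begin

text \<open>
  Until its first impulse a trajectory is an orbit of \<open>S\<close>, and the first impulse may come as late as
  desired.
\<close>
lemma bounded_cost_exponentially_stable: "exponentially_stable S"
proof (rule exponentially_stable_if_orbit_bound)
  fix t m :: real and x
  assume "0 \<le> t" "0 \<le> m" and m: "\<And>s. 0 \<le> s \<Longrightarrow> s \<le> t \<Longrightarrow> m \<le> norm (S s x) powr p"
  obtain \<sigma> where \<sigma>: "\<sigma> \<in> S_min T" "t < \<sigma> 1" using exists_S_min[OF T] .
  have "U S J \<sigma> s 0 = S s" if "s \<le> t" for s
    using no_impulse_before_first[of \<sigma> s 0] S_min_impulse_seqs[OF \<sigma>(1)] \<sigma>(2) that
    by (simp add: U_no_impulse)
  moreover have "ennreal (m * t) = (\<integral>\<^sup>+s\<in>{0..t}. ennreal m \<partial>lborel)"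
    using \<open>0 \<le> t\<close> \<open>0 \<le> m\<close> by (simp add: nn_integral_cmult_indicator ennreal_mult)
  ultimately have "ennreal (m * t) \<le> (\<integral>\<^sup>+s\<in>{0..}. ennreal (norm (U S J \<sigma> s 0 x) powr p) \<partial>lborel)"
    using m by (auto simp: indicator_def intro!: nn_integral_mono ennreal_leI)
  also have "\<dots> \<le> trajectory_cost S J p \<sigma> 0 x"
    by (simp add: trajectory_cost_def)
  also have "\<dots> \<le> ennreal (b powr p * norm x powr p)" by (rule cost[OF \<sigma>(1)])
  finally show "m * t \<le> b powr p * norm x powr p" by simp
qed (use p in simp)

text \<open>
  A cost starts with free flow, whereas \<open>W\<close> has to be evaluated at states immediately before an
  impulse. Hence \<open>W\<close> applies \<open>J\<close> first, and adds \<open>\<parallel>x\<parallel>\<^sup>p\<close> for the state before that impulse. The required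
  decrease is \<open>V_sup_prepend\<close> for gaps \<open>\<theta> \<ge> T\<close>.
\<close>
lemma bounded_cost_strongly_UGES: "strongly_UGES S J (S_min T)"
proof -
  have V_sup_le: "V_sup S J T p 0 x \<le> ennreal (b powr p * norm x powr p)" for x
    unfolding V_sup_def S_min_eq_S_clock_0[OF T, symmetric] by (rule SUP_least) (rule cost)
  define Y where "Y x = enn2real (V_sup S J T p 0 x)" for x
  have Y: "ennreal (Y x) = V_sup S J T p 0 x" for x
    using V_sup_le[of x] by (simp add: Y_def order_le_less_trans)
  have Y_le: "Y x \<le> b powr p * norm x powr p" for x
    using V_sup_le[of x] by (auto simp: Y_def intro: enn2real_leI)
  define W where "W x = norm x powr p + Y (J x)" for x
  have "norm x powr p + W (S \<theta> (J x)) \<le> W x" if "T \<le> \<theta>" for x \<theta>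
  proof -
    have "ennreal (norm (S \<theta> (J x)) powr p) + ennreal (Y (J (S \<theta> (J x)))) \<le> ennreal (Y (J x))"
      unfolding Y using prepend_in_S_min[OF _ T that] T p that S_min_eq_S_clock_0[OF T]
      by (intro V_sup_prepend) auto
    then have "norm (S \<theta> (J x)) powr p + Y (J (S \<theta> (J x))) \<le> Y (J x)"
      by (simp add: ennreal_plus[symmetric] Y_def del: ennreal_plus)
    then show ?thesis by (simp add: W_def)
  qed
  moreover have "W x \<le> (1 + b powr p * norm J powr p) * norm x powr p" for x
  proof -
    have "norm (J x) powr p \<le> (norm J * norm x) powr p"
      using p norm_blinfun[of J x] by (intro powr_mono2) auto
    then have "b powr p * norm (J x) powr p \<le> b powr p * (norm J powr p * norm x powr p)"
      by (intro mult_left_mono) (simp_all add: powr_mult)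
    then show ?thesis using Y_le[of "J x"] by (simp add: W_def algebra_simps)
  qed
  moreover have "0 \<le> W x" for x by (simp add: W_def Y_def)
  ultimately show ?thesis
    using bounded_cost_exponentially_stable T p
    by (intro strongly_UGES_if_impulse_to_impulse_decrease[where W=W]) auto
qed

end

end

section \<open>Equivalence of the stability conditions\<close>

text \<open>
  Before the first impulse, which may be arbitrarily late, the propagator is the semigroup.
\<close>
lemma growth_condition_imp_bounded_semigroup:
  assumes "growth_condition S J (S_min T)" "0 < T"
  obtains G where "1 \<le> G" "\<And>t. 0 \<le> t \<Longrightarrow> norm (S t) \<le> G"
proof -
  obtain g \<mu> where growth: "\<And>\<sigma> s t x. \<sigma> \<in> S_min T \<Longrightarrow> 0 \<le> s \<Longrightarrow> s \<le> t \<Longrightarrow>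
      norm (U S J \<sigma> t s x) \<le> g (t - s) * \<mu> ^ \<kappa> \<sigma> t s * norm x" and "bdd_above (g ` {0..})"
    using assms(1) unfolding growth_condition_def by blast
  from this(2) obtain G where G: "\<And>t. 0 \<le> t \<Longrightarrow> g t \<le> G"
    unfolding bdd_above_def by auto
  have "norm (S t) \<le> max 1 G" if "0 \<le> t" for t
  proof (rule norm_blinfun_bound)
    fix x
    obtain \<sigma> where \<sigma>: "\<sigma> \<in> S_min T" "t < \<sigma> 1" using exists_S_min[OF assms(2)] .
    then have "impulse_times \<sigma> \<inter> {0<..t} = {}"
      by (intro no_impulse_before_first S_min_impulse_seqs)
    then have "norm (S t x) \<le> g t * norm x"
      using growth[OF \<sigma>(1) order_refl that, of x] by (simp add: U_def \<kappa>_def)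
    also have "\<dots> \<le> max 1 G * norm x" using G[OF that] by (intro mult_right_mono) auto
    finally show "norm (S t x) \<le> max 1 G * norm x" .
  qed simp
  then show thesis using that[of "max 1 G"] by simp
qed

theorem theorem4p9:
  fixes D :: "'a::banach set" and A :: "'a \<Rightarrow> 'a"
    and S :: "real \<Rightarrow> ('a \<Rightarrow>\<^sub>L 'a)" and J :: "'a \<Rightarrow>\<^sub>L 'a" and T_min :: real
  assumes "generates_C0_semigroup D A S"
    and "J \<noteq> 0"
    and "blinfun_apply J ` D \<subseteq> D"
    and "T_min > 0"
    and "growth_condition S J (S_min T_min)"
  defines "cond_i \<equiv> strongly_UGES S J (S_min T_min)"
    and "cond_ii \<equiv> (\<exists>p\<ge>1. \<exists>b>0. \<forall>\<sigma>\<in>S_min T_min. \<forall>s\<ge>0. \<forall>x.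
           trajectory_cost S J p \<sigma> s x \<le> ennreal (b powr p * norm x powr p))"
    and "cond_iii \<equiv> (\<exists>p\<ge>1. \<exists>c>0. \<exists>V. clock_Lyapunov S J T_min p c V)"
    and "cond_iv \<equiv> exponentially_stable S \<and>
           (\<exists>p\<ge>1. \<exists>c>0. \<exists>V :: 'a \<Rightarrow> real.
              (\<forall>x. 0 \<le> V x) \<and>
              (\<forall>r>0. \<exists>L>0. L-lipschitz_on (ball 0 r) V) \<and>
              (\<forall>x. V x \<le> c * norm x powr p) \<and>
              (\<forall>x. \<forall>\<theta>\<ge>T_min.
                 V (blinfun_apply (S \<theta>) (blinfun_apply J x)) - V x \<le> - (norm x powr p)))"
  shows "(cond_i \<longleftrightarrow> cond_ii) \<and> (cond_i \<longleftrightarrow> cond_iii) \<and> (cond_i \<longleftrightarrow> cond_iv) \<and>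
    (\<forall>p\<ge>1. \<forall>c>0. \<forall>V. clock_Lyapunov S J T_min p c V \<longrightarrow> exponentially_stable S) \<and>
    (cond_i \<longrightarrow>
       (\<forall>p\<ge>1. (\<forall>\<tau>\<ge>0. \<forall>x. V_sup S J T_min p \<tau> x < \<infinity>) \<and>
              (\<exists>c>0. clock_Lyapunov S J T_min p c (\<lambda>\<tau> x. enn2real (V_sup S J T_min p \<tau> x)))))"
proof -
  note T = assms(4)
  obtain G where G: "1 \<le> G" "\<And>t. 0 \<le> t \<Longrightarrow> norm (S t) \<le> G"
    using growth_condition_imp_bounded_semigroup[OF assms(5) T] by blast
  interpret impulsive_flow S J G
    using assms(1) G by unfold_locales (auto simp: generates_C0_semigroup_def)
  have UGES_const: thesis if cond_i
    "\<And>M \<alpha> \<rho>. 1 \<le> M \<Longrightarrow> 0 < \<alpha> \<Longrightarrow> 0 < \<rho> \<Longrightarrow> \<rho> < 1 \<Longrightarrow>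
      (\<And>\<sigma> s. \<sigma> \<in> S_min T_min \<Longrightarrow> 0 \<le> s \<Longrightarrow> decays_from M \<alpha> \<rho> \<sigma> s) \<Longrightarrow> thesis" for thesis
    using that unfolding cond_i_def strongly_UGES_def decays_from_def by blast
  have i_imp_sup: "(\<forall>\<tau>\<ge>0. \<forall>x. V_sup S J T_min p \<tau> x < \<infinity>) \<and>
      (\<exists>c>0. clock_Lyapunov S J T_min p c (\<lambda>\<tau> x. enn2real (V_sup S J T_min p \<tau> x)))"
    if "cond_i" "1 \<le> p" for p
    using that(1)
  proof (rule UGES_const)
    fix M \<alpha> \<rho> assume c: "1 \<le> M" "0 < \<alpha>" "0 < \<rho>" "\<rho> < 1"
      "\<And>\<sigma> s. \<sigma> \<in> S_min T_min \<Longrightarrow> 0 \<le> s \<Longrightarrow> decays_from M \<alpha> \<rho> \<sigma> s"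
    then show ?thesis
      using V_sup_finite[OF c(1-4) that(2) T c(5)] cost_const_pos[OF c(1-4) that(2) T c(5)]
        clock_Lyapunov_V[OF c(1-4) that(2) T c(5)] by blast
  qed
  have i_imp_ii: cond_ii if cond_i
    using that
  proof (rule UGES_const)
    fix M \<alpha> \<rho> assume c: "1 \<le> M" "0 < \<alpha>" "0 < \<rho>" "\<rho> < 1"
      "\<And>\<sigma> s. \<sigma> \<in> S_min T_min \<Longrightarrow> 0 \<le> s \<Longrightarrow> decays_from M \<alpha> \<rho> \<sigma> s"
    let ?b = "cost_const M \<alpha> \<rho> 1"
    have "0 < ?b" by (rule cost_const_pos[OF c(1-4) order_refl T c(5)])
    moreover have "trajectory_cost S J 1 \<sigma> s x \<le> ennreal (?b powr 1 * norm x powr 1)"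
      if "\<sigma> \<in> S_min T_min" "0 \<le> s" for \<sigma> s x
      using S_min_cost_le[OF c(1-4) order_refl T c(5) that, of x] \<open>0 < ?b\<close> by simp
    ultimately show cond_ii unfolding cond_ii_def by (metis order_refl)
  qed
  have ii_imp_i: cond_i if ii: cond_ii
  proof -
    obtain p b where pb: "1 \<le> p" "\<And>\<sigma> s x. \<sigma> \<in> S_min T_min \<Longrightarrow> 0 \<le> s \<Longrightarrow>
        trajectory_cost S J p \<sigma> s x \<le> ennreal (b powr p * norm x powr p)"
      using ii unfolding cond_ii_def by blast
    show ?thesis
      unfolding cond_i_def using bounded_cost_strongly_UGES[OF T pb(1) pb(2)] by simp
  qed
  have i_imp_iii: cond_iii if cond_i
    using i_imp_sup[OF that order_refl] unfolding cond_iii_def by blast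
  have iii_imp_iv: cond_iv if iii: cond_iii
  proof -
    obtain p c W where W: "1 \<le> p" "0 < c" "clock_Lyapunov S J T_min p c W"
      using iii unfolding cond_iii_def by blast
    have "\<exists>L>0. L-lipschitz_on (ball 0 r) (W T_min)" if "0 < r" for r
      using clock_Lyapunov_lipschitz[OF W(3) that] T by auto
    moreover have "0 \<le> W T_min x" "W T_min x \<le> c * norm x powr p" for x
      using clock_Lyapunov_nonneg[OF W(3)] clock_Lyapunov_upper[OF W(3)] T by auto
    ultimately show ?thesis
      unfolding cond_iv_def
      using W(1,2) clock_Lyapunov_exponentially_stable[OF W(3) T W(1)]
        clock_Lyapunov_impulse_to_impulse[OF W(3) T] by blast
  qed
  have iv_imp_i: cond_i if iv: cond_iv
  proof -
    obtain p c W where W: "1 \<le> p" "\<And>x. 0 \<le> W x" "\<And>x. W x \<le> c * norm x powr p"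
      "\<And>x \<theta>. T_min \<le> \<theta> \<Longrightarrow> W (S \<theta> (J x)) - W x \<le> - (norm x powr p)"
      using iv unfolding cond_iv_def by blast
    have "norm x powr p + W (S \<theta> (J x)) \<le> W x" if "T_min \<le> \<theta>" for x \<theta>
      using W(4)[OF that, of x] by simp
    then show ?thesis
      using iv W(1-3) T unfolding cond_i_def cond_iv_def
      by (intro strongly_UGES_if_impulse_to_impulse_decrease[where W=W]) auto
  qed
  show ?thesis
    using i_imp_sup i_imp_ii ii_imp_i i_imp_iii iii_imp_iv iv_imp_i
      clock_Lyapunov_exponentially_stable[OF _ T] by blast
qed

end
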